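(* Let $f\in\mathbb{Z}[x]$ be irreducible over $\mathbb{Q}$, of degree $d\ge 2$. For $N\ge 1$ let $L_f(N):=\operatorname{lcm}\{f(n): n=1,\dots,N\}$. Then $\log L_f(N)\gg N\log N$ as $N\to\infty$; that is, there exist a constant $c>0$ and an integer $N_0$ (both allowed to depend on $f$) such that $$\log L_f(N)\ \ge\ c\,N\log N\qquad\text{for all integers } N\ge N_0 .$$
   Context: The least common multiple of a finite set of nonzero integers is taken to be the positive one (signs are ignored). Since $f$ is irreducible over $\mathbb{Q}$ of degree at least $2$, it has no rational zeros, so all values $f(n)$ are nonzero and $L_f(N)\geq 1$ is well defined. *)

theory Defs
  imports Complex_Main "HOL-Computational_Algebra.Computational_Algebra"
begin

(* On int, Lcm is normalized to be nonnegative, so signs of the values f(n) are ignored. *)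
definition lcm_values :: "int poly \<Rightarrow> nat \<Rightarrow> int" where
  "lcm_values f N = Lcm ((\<lambda>n. poly f (int n)) ` {1..N})"

end

(* Write rho(q) for the number of roots of f mod q and d for its degree. Factoring all values
   f(n), n <= N, into prime powers q, the powers q > N cost only a constant times log L_f(N),
   since each divides a bounded number of the values (Hensel uniqueness bounds rho). The powers
   q <= N cost N S(N) + O(N), where S(N) is the sum of rho(p) log p / p over primes p <= N, while
   the total is d N log N + O(N). So it suffices that S(N) <= (d - delta) log N + O(1) with some
   delta > 0; the trivial bound rho <= d gives only delta = 0.
   The saving comes from the homogenization F of f on the box |a|, |b| <= H with H ~ sqrt (2N).
   By irreducibility F vanishes only at the origin, so the product of its values is at most
   exp (4 H^2 (d log H + O(1))). On the other hand the lattices a = r b (mod p), f(r) = 0 (mod p),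
   contribute 4 H^2 S(H) from p <= H, and, by the pigeonhole principle, a positive proportion of
   H^2 (S(N) - S(H)) from H < p <= N <= H^2/2. *)
theory Submission
  imports Defs "HOL-Number_Theory.Cong" "HOL-Number_Theory.Prime_Powers"
begin

subsection \<open>Mangoldt, Chebyshev and Mertens estimates\<close>

lemma ln_prime_nonneg: "prime (p :: nat) \<Longrightarrow> 0 \<le> ln (real p)"
  using prime_ge_1_nat[of p] by simp

text \<open>The terms on the left are some of the nonnegative terms of the divisor sum of
  \<open>mangoldt\<close>, which equals \<open>ln m\<close>. This stands in for the remark that a
  product of distinct prime divisors of \<open>m\<close> divides \<open>m\<close>.\<close>

lemma sum_ln_prime_divisors_le:
  fixes m :: nat
  assumes "m > 0" "\<And>p. p \<in> S \<Longrightarrow> prime p \<and> p dvd m"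
  shows "(\<Sum>p\<in>S. ln (real p)) \<le> ln (real m)"
proof -
  have "(\<Sum>p\<in>S. ln (real p)) = (\<Sum>p\<in>S. mangoldt p)"
    using assms by (intro sum.cong) auto
  also have "\<dots> \<le> (\<Sum>d | d dvd m. mangoldt d)"
    using assms by (intro sum_mono2) (auto simp: mangoldt_nonneg)
  also have "\<dots> = ln (real m)"
    using mangoldt_sum[of m, where ?'a = real] assms by simp
  finally show ?thesis .
qed

text \<open>Erdos's argument. An even \<open>n > 2\<close> is not prime and reduces to
  \<open>n - 1\<close>. For \<open>n = 2 * m + 1\<close> the primes in \<open>(m + 1, n]\<close>
  divide the binomial coefficient \<open>n choose m\<close>, since they divide \<open>n!\<close> but
  neither \<open>m!\<close> nor \<open>(m + 1)!\<close>, and this coefficient is at most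
  \<open>4 ^ m\<close>.\<close>

lemma theta_le: "(\<Sum>p | prime p \<and> p \<le> n. ln (real p)) \<le> real n * ln 4"
proof (induction n rule: less_induct)
  case (less n)
  consider "n \<le> 1" | "n = 2" | "n > 2" "even n" | m where "n = 2 * m + 1" "m \<ge> 1"
  proof (cases "even n")
    case True
    then show ?thesis using that(1-3) by linarith
  next
    case False
    then obtain m where "n = 2 * m + 1" by (rule oddE)
    then show ?thesis using that(1) that(4)[of m] by (cases "m = 0") auto
  qed
  then show ?case
  proof cases
    case 1
    then have "{p. prime p \<and> p \<le> n} = {}" 
      by (auto dest: prime_gt_1_nat)
    then have "(\<Sum>p | prime p \<and> p \<le> n. ln (real p)) = 0" by (simp only: sum.empty)
    then show ?thesis by simp
  next
    case 2
    then have "{p. prime p \<and> p \<le> n} = {2}" 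
      by (auto dest: prime_ge_2_nat)
    moreover have "ln (2 :: real) \<le> 2 * ln 4" using ln_realpow[of 2 2] by simp
    ultimately show ?thesis using 2 by simp
  next
    case 3
    then have "{p. prime p \<and> p \<le> n} = {p. prime p \<and> p \<le> n - 1}"
      using prime_odd_nat[of n] by (auto simp: le_less)
    then have "(\<Sum>p | prime p \<and> p \<le> n. ln (real p)) \<le> real (n - 1) * ln 4"
      using less.IH[of "n - 1"] 3 by simp
    also have "\<dots> \<le> real n * ln 4" by (intro mult_right_mono) auto
    finally show ?thesis .
  next
    case 4
    let ?C = "(2 * m + 1) choose m"
    have split: "{p. prime p \<and> p \<le> n} = {p. prime p \<and> p \<le> m + 1} \<union> {p. prime p \<and> m + 1 < p \<and> p \<le> n}"
      using 4 by auto
    have "(\<Sum>p | prime p \<and> p \<le> n. ln (real p)) =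
       (\<Sum>p | prime p \<and> p \<le> m + 1. ln (real p)) + (\<Sum>p | prime p \<and> m + 1 < p \<and> p \<le> n. ln (real p))"
      unfolding split by (rule sum.union_disjoint) auto
    moreover have "(\<Sum>p | prime p \<and> p \<le> m + 1. ln (real p)) \<le> real (m + 1) * ln 4"
      using less.IH[of "m + 1"] 4 by simp
    moreover have "(\<Sum>p | prime p \<and> m + 1 < p \<and> p \<le> n. ln (real p)) \<le> ln (real ?C)"
    proof (rule sum_ln_prime_divisors_le)
      fix p assume "p \<in> {p. prime p \<and> m + 1 < p \<and> p \<le> n}"
      then have p: "prime p" "m + 1 < p" "p \<le> n" by auto
      have "fact m * fact (m + 1) * ?C = (fact n :: nat)"
        using binomial_fact_lemma[of m "2 * m + 1"] 4 by simp
      then have "p dvd fact m * fact (m + 1) * ?C"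
        using p by (simp only: prime_dvd_fact_iff)
      moreover have "\<not> p dvd fact m" "\<not> p dvd fact (m + 1)"
        using p by (simp_all only: prime_dvd_fact_iff)
      ultimately show "prime p \<and> p dvd ?C"
        using p(1) prime_dvd_mult_iff by blast
    qed auto
    moreover have "ln (real ?C) \<le> real m * ln 4"
    proof -
      \<comment> \<open>The two middle coefficients are equal and belong to a row with sum
        \<open>2 * 4 ^ m\<close>, so each is at most \<open>4 ^ m\<close>.\<close>
      have "?C + ((2 * m + 1) choose (m + 1)) \<le> 2 ^ (2 * m + 1)"
      proof -
        have "(\<Sum>k\<in>{m, m + 1}. (2 * m + 1) choose k) \<le> (\<Sum>k\<le>2 * m + 1. (2 * m + 1) choose k)"
          by (rule sum_mono2) auto
        then show ?thesis unfolding choose_row_sum by (simp del: binomial_Suc_Suc)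
      qed
      moreover have "((2 * m + 1) choose (m + 1)) = ?C"
        using binomial_symmetric[of m "2 * m + 1"] by simp
      ultimately have "?C \<le> 4 ^ m" by (simp add: power_mult)
      then have "real ?C \<le> 4 ^ m" by (metis of_nat_le_iff of_nat_numeral of_nat_power)
      then have "ln (real ?C) \<le> ln (4 ^ m)" by (subst ln_le_cancel_iff) auto
      then show ?thesis by (simp add: ln_realpow)
    qed
    ultimately show ?thesis using 4 by (simp add: algebra_simps)
  qed
qed

section \<open>Legendre's formula and a Stirling-type lower bound for the factorial\<close>

lemma ln_fact_eq_sum: "ln (fact N :: real) = (\<Sum>n\<in>{1..N}. ln (real n))"
  by (induction N) (auto simp: ln_mult)

text \<open>Write each \<open>ln n\<close> as a divisor sum of \<open>mangoldt\<close> and exchange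
  the sums: \<open>N div q\<close> is the number of multiples of \<open>q\<close> up to
  \<open>N\<close>.\<close>

lemma ln_fact_mangoldt: "ln (fact N) = (\<Sum>q\<in>{1..N}. mangoldt q * real (N div q))"
proof -
  have "ln (fact N) = (\<Sum>n\<in>{1..N}. ln (real n))" by (rule ln_fact_eq_sum)
  also have "\<dots> = (\<Sum>n\<in>{1..N}. \<Sum>q | q \<in> {1..N} \<and> q dvd n. mangoldt q)"
  proof (rule sum.cong)
    fix n assume n: "n \<in> {1..N}"
    then have "{q. q dvd n} = {q. q \<in> {1..N} \<and> q dvd n}"
      by (auto dest: dvd_imp_le intro: Nat.gr0I)
    then show "ln (real n) = (\<Sum>q | q \<in> {1..N} \<and> q dvd n. mangoldt q)"
      using mangoldt_sum[of n, where ?'a = real] n by simp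
  qed auto
  also have "\<dots> = (\<Sum>q\<in>{1..N}. \<Sum>n | n \<in> {1..N} \<and> q dvd n. mangoldt q)"
    by (rule sum.swap_restrict) auto
  also have "\<dots> = (\<Sum>q\<in>{1..N}. mangoldt q * real (N div q))"
  proof (rule sum.cong)
    fix q assume q: "q \<in> {1..N}"
    have "{n. n \<in> {1..N} \<and> q dvd n} = (\<lambda>k. q * k) ` {1..N div q}"
      using q by (auto simp: image_iff less_eq_div_iff_mult_less_eq mult.commute elim!: dvdE)
    moreover have "inj_on (\<lambda>k. q * k) {1..N div q}" using q by (auto simp: inj_on_def)
    ultimately show "(\<Sum>n | n \<in> {1..N} \<and> q dvd n. mangoldt q) = mangoldt q * real (N div q)"
      by (simp add: card_image mult.commute)
  qed auto
  finally show ?thesis .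
qed

lemma ln_Suc_diff_le:
  assumes "n > 0"
  shows "ln (real (Suc n)) \<le> ln (real n) + 1 / real n"
proof -
  have "1 + 1 / real n = real (Suc n) / real n" using assms by (simp add: field_simps)
  then have "ln (real (Suc n)) - ln (real n) = ln (1 + 1 / real n)"
    using assms by (simp add: ln_div)
  also have "\<dots> \<le> 1 / real n" by (intro ln_add_one_self_le_self) auto
  finally show ?thesis by simp
qed

lemma ln_fact_ge: "ln (fact N) \<ge> real N * ln (real N) - real N"
proof (induction N)
  case (Suc N)
  show ?case
  proof (cases "N = 0")
    case False
    then have "real N * (ln (real (Suc N)) - ln (real N)) \<le> 1"
      using ln_Suc_diff_le[of N] False by (simp add: field_simps)
    moreover have "ln (fact (Suc N)) = ln (real (Suc N)) + ln (fact N)"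
      by (simp add: ln_mult del: of_nat_Suc)
    ultimately show ?thesis using Suc by (simp add: algebra_simps)
  qed auto
qed auto

section \<open>Mertens' first theorem with explicit constants\<close>

lemma real_div_minus_one_le: "real a / real b - 1 \<le> real (a div b)"
proof -
  have "real_of_int \<lfloor>real a / real b\<rfloor> = real (a div b)"
    by (simp add: floor_divide_of_nat_eq)
  then show ?thesis by linarith
qed

text \<open>Keep only the primes in Legendre's formula. Removing the floors costs the sum of
  \<open>ln p\<close> over \<open>p <= N\<close>, at most \<open>N * ln 4\<close> by Chebyshev, and
  \<open>N! <= N ^ N\<close> bounds the rest.\<close>

lemma sum_ln_prime_over_le:
  assumes "N \<ge> 1"
  shows "(\<Sum>p | prime p \<and> p \<le> N. ln (real p) / real p) \<le> ln (real N) + ln 4"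
proof -
  let ?P = "{p. prime p \<and> p \<le> N}"
  have "real N * (\<Sum>p\<in>?P. ln (real p) / real p) - (\<Sum>p\<in>?P. ln (real p))
      = (\<Sum>p\<in>?P. ln (real p) * (real N / real p - 1))"
    by (simp add: sum_distrib_left sum_subtractf [symmetric] algebra_simps)
  also have "\<dots> \<le> (\<Sum>p\<in>?P. mangoldt p * real (N div p))"
  proof (rule sum_mono)
    fix p assume p: "p \<in> ?P"
    have "real N / real p - 1 \<le> real (N div p)"
      by (rule real_div_minus_one_le)
    then show "ln (real p) * (real N / real p - 1) \<le> mangoldt p * real (N div p)"
      using p prime_ge_1_nat[of p] by (simp add: mult_left_mono)
  qed
  also have "\<dots> \<le> (\<Sum>q\<in>{1..N}. mangoldt q * real (N div q))"
    by (rule sum_mono2) (auto simp: mangoldt_nonneg prime_ge_1_nat Suc_le_eq prime_gt_0_nat)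
  also have "\<dots> = ln (fact N)" by (rule ln_fact_mangoldt [symmetric])
  also have "\<dots> \<le> ln (real N ^ N)"
    using assms fact_le_power[of N, where ?'a = real] by (subst ln_le_cancel_iff) auto
  also have "\<dots> = real N * ln (real N)" using assms by (simp add: ln_realpow)
  finally have "real N * (\<Sum>p\<in>?P. ln (real p) / real p) \<le> real N * (ln (real N) + ln 4)"
    using theta_le[of N] by (simp add: algebra_simps)
  then show ?thesis using assms by simp
qed

lemma sum_ln_over_square_le:
  assumes "finite A"
  shows "(\<Sum>n\<in>A. ln (real n) / real n ^ 2) \<le> 2"
proof -
  \<comment> \<open>An antiderivative of \<open>ln x / x^2\<close> is
    \<open>-(ln x + 1) / x\<close>; the extra \<open>1 / x\<close> gives the slack for the
    induction. At \<open>m = 1\<close> both sides are 0.\<close>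
  have part: "(\<Sum>n\<in>{1..m}. ln (real n) / real n ^ 2) \<le> 2 - (ln (real m) + 2) / real m"
    if "m \<ge> 1" for m
    using that
  proof (induction m rule: dec_induct)
    case base
    show ?case by simp
  next
    case (step m)
    define x l where "x = real m" and "l = ln x"
    have x: "x \<ge> 1" "l \<ge> 0" using step by (auto simp: x_def l_def)
    have ln: "ln (x + 1) \<le> l + 1 / x" 
      using ln_Suc_diff_le[of m] step by (simp add: x_def l_def add.commute)
    have "ln (x + 1) / (x + 1) ^ 2 + (ln (x + 1) + 2) / (x + 1)
        \<le> (l + 1 / x) / (x + 1) ^ 2 + (l + 1 / x + 2) / (x + 1)"
      using ln x by (intro add_mono divide_right_mono) auto
    also have "\<dots> = (l + 2) / x - ((l + 1) * (x + 1) - (l * x + 1)) / (x * (x + 1) ^ 2)"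
      using x by (simp add: divide_simps power2_eq_square) (simp add: algebra_simps)
    \<comment> \<open>The numerator of the subtracted fraction simplifies to \<open>l + x\<close>,
      which is nonnegative.\<close>
    also have "\<dots> \<le> (l + 2) / x"
      using x by (simp add: algebra_simps)
    finally show ?case using step by (simp add: x_def l_def add.commute)
  qed
  obtain m where m: "\<And>n. n \<in> A \<Longrightarrow> n \<le> m"
    using assms by (meson finite_nat_set_iff_bounded_le)
  \<comment> \<open>The term at \<open>n = 0\<close> is 0, since division by zero gives 0.\<close>
  have "(\<Sum>n\<in>A. ln (real n) / real n ^ 2) = (\<Sum>n\<in>A - {0}. ln (real n) / real n ^ 2)"
    using assms by (intro sum.mono_neutral_right) auto
  also have "\<dots> \<le> (\<Sum>n\<in>{1..Suc m}. ln (real n) / real n ^ 2)"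
    by (intro sum_mono2) (auto dest: m simp: le_SucI)
  also have "\<dots> \<le> 2 - (ln (real (Suc m)) + 2) / real (Suc m)" by (rule part) simp
  also have "\<dots> \<le> 2" by simp
  finally show ?thesis .
qed

text \<open>Only the powers \<open>p ^ k\<close> with \<open>k >= 2\<close> count. Their geometric
  series is at most \<open>2 / p^2\<close>, and the sum of \<open>ln p / p^2\<close> is at most
  2.\<close>

lemma sum_mangoldt_nonprime_le:
  fixes A :: "nat set"
  assumes A: "finite A" "\<And>q. q \<in> A \<Longrightarrow> \<not> prime q"
  shows "(\<Sum>q\<in>A. mangoldt q / real q) \<le> (4 :: real)"
proof -
  have geom: "(\<Sum>k\<in>{2..m}. 1 / real p ^ k) \<le> 2 / real p ^ 2" if "p \<ge> 2" for p m :: nat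
  proof -
    \<comment> \<open>The subtracted \<open>1 / p ^ m\<close> carries the induction: it pays for two
      copies of the next term because \<open>p >= 2\<close>.\<close>
    have "(\<Sum>k\<in>{2..m}. 1 / real p ^ k) \<le> 2 / real p ^ 2 - 1 / real p ^ m" if "m \<ge> 2" for m
      using that
    proof (induction m rule: dec_induct)
      case base show ?case by simp
    next
      case (step m)
      have "1 / real p ^ Suc m + 1 / real p ^ Suc m \<le> 1 / real p ^ m"
        using \<open>p \<ge> 2\<close> by (simp add: field_simps)
      then show ?case using step by simp
    qed
    from this[of m] show ?thesis 
      by (cases "m \<ge> 2") (auto intro: order_trans)
  qed
    obtain m where m: "\<And>q. q \<in> A \<Longrightarrow> q \<le> m" using A(1) by (meson finite_nat_set_iff_bounded_le)
    define B where "B = {p. prime p \<and> p \<le> m} \<times> {2..m}"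
    have finB: "finite B" by (simp add: B_def)
    have sub: "{q \<in> A. primepow q} \<subseteq> (\<lambda>(p, k). p ^ k) ` B"
    proof
      fix q assume q: "q \<in> {q \<in> A. primepow q}"
      then obtain p k where pk: "prime p" "k > 0" "q = p ^ k" by (auto simp: primepow_def)
      have "k \<noteq> 1" using A(2)[of q] q pk by auto
      moreover have "p \<le> p ^ k" using pk prime_ge_1_nat[of p] self_le_power[of p k] by simp
      moreover have "k < p ^ k" by (rule power_gt_expt) (use pk prime_gt_1_nat[of p] in auto)
      moreover have "q \<le> m" using q m by auto
      ultimately show "q \<in> (\<lambda>(p, k). p ^ k) ` B" using pk
        by (intro image_eqI[of _ _ "(p, k)"]) (auto simp: B_def)
    qed
    have "(\<Sum>q\<in>A. mangoldt q / real q) = (\<Sum>q\<in>{q \<in> A. primepow q}. mangoldt q / real q)"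
      using A(1) by (intro sum.mono_neutral_right) (auto simp: mangoldt_def)
    also have "\<dots> \<le> (\<Sum>q\<in>(\<lambda>(p, k). p ^ k) ` B. mangoldt q / real q)"
      using finB sub by (intro sum_mono2) (auto simp: mangoldt_nonneg)
    also have "\<dots> \<le> (\<Sum>(p, k)\<in>B. mangoldt (p ^ k) / real (p ^ k))"
      using sum_image_le[OF finB, of "\<lambda>q. mangoldt q / real q" "\<lambda>(p, k). p ^ k"]
      by (simp add: mangoldt_nonneg case_prod_unfold o_def)
    also have "\<dots> = (\<Sum>p | prime p \<and> p \<le> m. ln (real p) * (\<Sum>k\<in>{2..m}. 1 / real p ^ k))"
      unfolding B_def sum.cartesian_product [symmetric] sum_distrib_left
      by (intro sum.cong) auto
    also have "\<dots> \<le> (\<Sum>p | prime p \<and> p \<le> m. ln (real p) * (2 / real p ^ 2))"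
      by (intro sum_mono mult_left_mono geom) (auto simp: prime_ge_2_nat ln_prime_nonneg)
    also have "\<dots> = 2 * (\<Sum>p | prime p \<and> p \<le> m. ln (real p) / real p ^ 2)"
      by (simp add: sum_distrib_left algebra_simps)
    also have "\<dots> \<le> 4" using sum_ln_over_square_le[of "{p. prime p \<and> p \<le> m}"] by simp
    finally show ?thesis .
qed

text \<open>The constant 5 is 1 from the lower bound for \<open>ln (fact N)\<close> plus 4 from the
  proper prime powers in Legendre's formula.\<close>

lemma sum_ln_prime_over_ge:
  assumes N: "N \<ge> 1"
  shows "ln (real N) - 5 \<le> (\<Sum>p | prime p \<and> p \<le> N. ln (real p) / real p)"
proof -
    have split: "{1..N} = {p. prime p \<and> p \<le> N} \<union> {q\<in>{1..N}. \<not> prime q}"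
      by (auto simp: Suc_le_eq prime_gt_0_nat)
    have "real N * (ln (real N) - 1) \<le> (\<Sum>q\<in>{1..N}. mangoldt q * real (N div q))"
      using ln_fact_ge[of N] by (simp add: ln_fact_mangoldt algebra_simps)
    also have "\<dots> \<le> (\<Sum>q\<in>{1..N}. mangoldt q * (real N / real q))"
      by (intro sum_mono mult_left_mono) (auto simp: mangoldt_nonneg of_nat_div_le_of_nat)
    also have "\<dots> = real N * (\<Sum>q\<in>{1..N}. mangoldt q / real q)"
      by (simp add: sum_distrib_left algebra_simps)
    also have "(\<Sum>q\<in>{1..N}. mangoldt q / real q) = (\<Sum>p | prime p \<and> p \<le> N. mangoldt p / real p)
        + (\<Sum>q | q \<in> {1..N} \<and> \<not> prime q. mangoldt q / real q)"
      by (subst split, rule sum.union_disjoint) auto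
    also have "real N * \<dots> \<le> real N * ((\<Sum>p | prime p \<and> p \<le> N. ln (real p) / real p) + 4)"
      by (intro mult_left_mono add_mono sum_mangoldt_nonprime_le) auto
    finally have "real N * (ln (real N) - 1) \<le> real N * ((\<Sum>p | prime p \<and> p \<le> N. ln (real p) / real p) + 4)" .
    then show ?thesis using N by simp
qed

subsection \<open>Roots of integer polynomials modulo prime powers\<close>

lemma poly_map_poly_of_int:
  fixes f :: "int poly"
  shows "poly (map_poly of_int f) (of_int x :: 'a :: comm_ring_1) = of_int (poly f x)"
  by (induction f) (auto simp: map_poly_pCons)

lemma pderiv_map_poly_of_int:
  fixes f :: "int poly"
  shows "pderiv (map_poly of_int f :: rat poly) = map_poly of_int (pderiv f)"
  by (intro poly_eqI) (simp add: coeff_pderiv coeff_map_poly)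

lemma clear_denominators:
  fixes u :: "rat poly"
  obtains D :: int and U :: "int poly" where "D \<noteq> 0" "smult (of_int D) u = map_poly of_int U"
proof -
  have "\<exists>D U. D \<noteq> 0 \<and> smult (rat_of_int D) u = map_poly of_int U"
  proof (induction u)
    case 0
    show ?case by (intro exI[of _ 1] exI[of _ 0]) simp
  next
    case (pCons a u)
    then obtain D U where DU: "D \<noteq> 0" "smult (rat_of_int D) u = map_poly of_int U" by blast
    obtain x y where xy: "y \<noteq> 0" "a = rat_of_int x / rat_of_int y"
      by (metis Fract_of_int_quotient Rat_cases less_irrefl)
    have "smult (rat_of_int (D * y)) (pCons a u) = pCons (of_int (D * x)) (smult (of_int y) (smult (of_int D) u))"
      using xy by (simp add: mult.commute)
    also have "\<dots> = map_poly of_int (pCons (D * x) (smult y U))"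
      unfolding DU(2) by (intro poly_eqI) (simp add: coeff_map_poly coeff_pCons split: nat.split)
    finally show ?case using DU(1) xy(1) by (intro exI[of _ "D * y"] exI) auto
  qed
  then show ?thesis using that by blast
qed

text \<open>A nonzero element of least degree in the ideal generated by \<open>F\<close> and
  \<open>G\<close> divides both, and irreducibility makes it a unit.\<close>

lemma irreducible_poly_bezout:
  fixes F G :: "'a :: field poly"
  assumes irr: "irreducible F" and ndvd: "\<not> F dvd G"
  obtains u v where "u * F + v * G = 1"
proof -
  \<comment> \<open>The zero combination is excluded because 0 also has degree 0 and would spoil the
    minimal choice.\<close>
  define I where "I = {u * F + v * G |u v. u * F + v * G \<noteq> 0}"
  have FI: "F \<in> I"
    using irr unfolding I_def by (intro CollectI exI[of _ 1] exI[of _ 0]) auto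
  obtain g where g: "g \<in> I" "\<And>h. h \<in> I \<Longrightarrow> degree g \<le> degree h"
    using ex_has_least_nat[of "\<lambda>h. h \<in> I" F degree] FI by blast
  obtain u v where uv: "g = u * F + v * G" "g \<noteq> 0" using g(1) by (auto simp: I_def)
  have "g dvd s * F + t * G" for s t
  proof (rule ccontr)
    let ?h = "s * F + t * G"
    assume "\<not> g dvd ?h"
    then have nz: "?h mod g \<noteq> 0" by (simp add: dvd_eq_mod_eq_0)
    have "?h mod g = (s - ?h div g * u) * F + (t - ?h div g * v) * G"
      using div_mult_mod_eq[of ?h g] uv(1) by (simp add: algebra_simps)
    then have "?h mod g \<in> I" using nz unfolding I_def by auto
    then show False using g(2) degree_mod_less'[OF uv(2) nz] by fastforce
  qed
  from this[of 1 0] this[of 0 1] have dvd: "g dvd F" "g dvd G" by auto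
  have "is_unit g"
  proof -
    obtain k where k: "F = g * k" using dvd(1) by blast
    then have "is_unit g \<or> is_unit k" using irr by (simp add: irreducibleD)
    \<comment> \<open>If \<open>k\<close> were a unit, \<open>F\<close> would be associated to
      \<open>g\<close> and hence divide \<open>G\<close>.\<close>
    moreover have "\<not> is_unit k" using k dvd(2) ndvd by (auto simp: mult_unit_dvd_iff)
    ultimately show ?thesis by blast
  qed
  then obtain w where "1 = g * w" by blast
  then have "(w * u) * F + (w * v) * G = 1" unfolding uv(1) by (simp add: algebra_simps)
  then show ?thesis by (rule that)
qed

text \<open>In characteristic 0 the derivative is nonzero of smaller degree, so \<open>F\<close>
  does not divide it; clear denominators in the resulting Bezout identity. \<open>D\<close> plays
  the part of a discriminant: a common divisor of \<open>f(x)\<close> and \<open>f'(x)\<close>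
  divides it.\<close>

lemma irreducible_separable:
  fixes f :: "int poly"
  assumes irr: "irreducible (map_poly of_int f :: rat poly)" and deg: "degree f > 0"
  obtains D :: int where "D \<noteq> 0"
    "\<And>x. \<exists>s t. D = s * poly f x + t * poly (pderiv f) x"
proof -
  define F :: "rat poly" where "F = map_poly of_int f"
  have degF: "degree F = degree f" by (simp add: F_def degree_map_poly)
  have "\<not> F dvd pderiv F"
  proof
    assume "F dvd pderiv F"
    moreover have "pderiv F \<noteq> 0" using deg degF by (simp add: pderiv_eq_0_iff)
    ultimately have "degree F \<le> degree (pderiv F)" by (rule dvd_imp_degree_le)
    then show False using deg degF by (simp add: degree_pderiv)
  qed
  then obtain u v where uv: "u * F + v * pderiv F = 1"
    using irreducible_poly_bezout irr unfolding F_def by blast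
  obtain D1 U where D1: "D1 \<noteq> 0" "smult (of_int D1) u = map_poly of_int U"
    by (rule clear_denominators)
  obtain D2 V where D2: "D2 \<noteq> 0" "smult (of_int D2) v = map_poly of_int V"
    by (rule clear_denominators)
  show ?thesis
  proof (rule that[of "D1 * D2"])
    show "D1 * D2 \<noteq> 0" using D1 D2 by simp
  next
    fix x :: int
    let ?x = "rat_of_int x"
    have F: "poly F ?x = of_int (poly f x)" "poly (pderiv F) ?x = of_int (poly (pderiv f) x)"
      by (simp_all add: F_def pderiv_map_poly_of_int poly_map_poly_of_int)
    have U: "of_int D1 * poly u ?x = of_int (poly U x)"
      using arg_cong[OF D1(2), of "\<lambda>p. poly p ?x"] by (simp add: poly_map_poly_of_int)
    have V: "of_int D2 * poly v ?x = of_int (poly V x)"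
      using arg_cong[OF D2(2), of "\<lambda>p. poly p ?x"] by (simp add: poly_map_poly_of_int)
    have "poly u ?x * of_int (poly f x) + poly v ?x * of_int (poly (pderiv f) x) = 1"
      using arg_cong[OF uv, of "\<lambda>p. poly p ?x"] by (simp add: F)
    then have "rat_of_int (D1 * D2) = of_int D2 * (of_int D1 * poly u ?x) * of_int (poly f x)
         + of_int D1 * (of_int D2 * poly v ?x) * of_int (poly (pderiv f) x)"
      by (simp add: algebra_simps flip: distrib_left)
    also have "\<dots> = of_int (D2 * poly U x * poly f x + D1 * poly V x * poly (pderiv f) x)"
      unfolding U V by simp
    finally have "D1 * D2 = D2 * poly U x * poly f x + D1 * poly V x * poly (pderiv f) x"
      by (simp only: of_int_eq_iff)
    then show "\<exists>s t. D1 * D2 = s * poly f x + t * poly (pderiv f) x" by blast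
  qed
qed

section \<open>Counting roots modulo primes and prime powers\<close>

lemma poly_taylor_first_order:
  fixes f :: "int poly"
  obtains w where "poly f x - poly f y = (x - y) * (poly (pderiv f) y + (x - y) * w)"
proof -
  have "\<exists>w. poly f x - poly f y = (x - y) * (poly (pderiv f) y + (x - y) * w)"
  proof (induction f)
    case (pCons a f)
    then obtain w where w: "poly f x = poly f y + (x - y) * (poly (pderiv f) y + (x - y) * w)"
      by (metis add.commute diff_add_cancel)
    show ?case
      \<comment> \<open>From \<open>x f(x) - y f(y) = (x - y) f(y) + x (f(x) - f(y))\<close>; the
        summand \<open>f'(y)\<close> arises on replacing \<open>x f'(y)\<close> by
        \<open>y f'(y) + (x - y) f'(y)\<close>.\<close>
      by (intro exI[of _ "x * w + poly (pderiv f) y"])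
         (simp add: pderiv_pCons w algebra_simps)
  qed auto
  then show ?thesis using that by blast
qed

text \<open>This is rho(q).\<close>

definition num_roots_mod :: "int poly \<Rightarrow> nat \<Rightarrow> nat" where
  "num_roots_mod f q = card {r \<in> {0..<int q}. int q dvd poly f r}"

lemma dvd_poly_diff:
  fixes f :: "int poly"
  shows "(x - y) dvd (poly f x - poly f y)"
proof -
  obtain w where "poly f x - poly f y = (x - y) * (poly (pderiv f) y + (x - y) * w)"
    using poly_taylor_first_order .
  then show ?thesis by simp
qed

text \<open>Lagrange's theorem. Splitting off a root \<open>r\<close> modulo \<open>p\<close> leaves
  the remainder \<open>f(r)\<close>, divisible by \<open>p\<close>; as \<open>p\<close> is prime,
  every other root is a root of the quotient, which has the same leading coefficient.\<close>

lemma num_roots_mod_prime_le: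
  assumes "prime p" "\<not> int p dvd lead_coeff f"
  shows "num_roots_mod f p \<le> degree f"
  using assms(2)
proof (induction "degree f" arbitrary: f)
  case 0
  then obtain c where "f = [:c:]" by (metis degree_eq_zeroE)
  then show ?case using 0 by (simp add: num_roots_mod_def)
next
  case (Suc d)
  let ?R = "\<lambda>f. {r \<in> {0..<int p}. int p dvd poly f r}"
  show ?case
  proof (cases "?R f = {}")
    case False
    then obtain r where r: "r \<in> ?R f" by blast
    define g where "g = synthetic_div f r"
    have f: "f = [:-r, 1:] * g + [:poly f r:]" unfolding g_def by (rule synthetic_div_correct' [symmetric])
    have dg: "degree g = d" using Suc(2) by (simp add: g_def degree_synthetic_div)
    have "g \<noteq> 0" using Suc(2) by (simp add: g_def synthetic_div_eq_0_iff)
    then have "degree ([:-r, 1:] * g) > 0" by (subst degree_mult_eq) auto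
    then have "lead_coeff ([:poly f r:] + [:-r, 1:] * g) = lead_coeff ([:-r, 1:] * g)"
      by (intro lead_coeff_add_le) simp
    also have "\<dots> = lead_coeff g" by (subst lead_coeff_mult) simp
    finally have "lead_coeff f = lead_coeff g" using f by (metis add.commute)
    then have IH: "num_roots_mod g p \<le> d"
      using Suc(1)[of g] Suc(3) dg by simp
    have "?R f \<subseteq> insert r (?R g)"
    proof
      fix x assume x: "x \<in> ?R f"
      have "poly f x = (x - r) * poly g x + poly f r"
        by (subst f) (simp add: algebra_simps)
      then have "int p dvd (x - r) * poly g x"
        using x r by (metis (mono_tags, lifting) dvd_add_left_iff mem_Collect_eq)
      then have "int p dvd x - r \<or> int p dvd poly g x"
        using assms(1) by (simp add: prime_dvd_mult_iff)
      moreover have "x = r" if "int p dvd x - r"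
        using that x r by (auto simp: mod_eq_dvd_iff [symmetric])
      ultimately show "x \<in> insert r (?R g)" using x by auto
    qed
    moreover have fin: "finite (?R g)" by (rule finite_subset[of _ "{0..<int p}"]) auto
    ultimately have "card (?R f) \<le> card (insert r (?R g))" by (intro card_mono) simp
    also have "\<dots> \<le> Suc (card (?R g))" using fin by (simp add: card_insert_if)
    finally show ?thesis using IH Suc(2) by (simp add: num_roots_mod_def)
  next
    case True
    then show ?thesis unfolding num_roots_mod_def by (simp only: card.empty)
  qed
qed


lemma div_less_of_less_mult:
  fixes x q n :: int
  assumes "0 < q" "x < n * q"
  shows "x div q < n"
proof (rule ccontr)
  assume "\<not> x div q < n"
  then have "n * q \<le> x div q * q" using assms(1) by (intro mult_right_mono) auto
  also have "\<dots> \<le> x" using assms(1) div_mult_mod_eq[of x q] pos_mod_sign[of q x] by linarith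
  finally show False using assms(2) by simp
qed

text \<open>What matters is uniformity in \<open>p\<close> and \<open>k\<close>. For
  \<open>k > 0\<close>, \<open>degree f\<close> covers the primes not dividing \<open>D\<close>, and
  \<open>|D|^3\<close> covers the finitely many others. Since the leading coefficient divides
  \<open>D\<close>, Lagrange's theorem applies to the former.\<close>

lemma num_roots_mod_primepow_le:
  assumes D: "D \<noteq> 0" "\<And>x. \<exists>s t. D = s * poly f x + t * poly (pderiv f) x"
    and lc: "lead_coeff f dvd D" and p: "prime p"
  shows "num_roots_mod f (p ^ k) \<le> degree f + nat \<bar>D\<bar> ^ 3"
proof -
  let ?P = "int p"
  define e where "e = multiplicity ?P D"
  have P: "prime ?P" "?P > 1" using p prime_gt_1_nat[of p] by auto
  have pe: "?P ^ e dvd D" "\<not> ?P ^ Suc e dvd D"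
    using P D(1) by (simp add: e_def multiplicity_dvd, subst power_dvd_iff_le_multiplicity) (auto simp: e_def)
  have pe_le: "p ^ e \<le> nat \<bar>D\<bar>"
    using dvd_imp_le_int[OF D(1) pe(1)] P by (simp add: nat_le_iff le_nat_iff)
  let ?R = "{x \<in> {0..<?P ^ k}. ?P ^ k dvd poly f x}"
  have num: "num_roots_mod f (p ^ k) = card ?R" by (simp add: num_roots_mod_def)
  \<comment> \<open>Since \<open>P ^ Suc e\<close> does not divide \<open>D\<close>, it does not divide \<open>f'\<close> at a root modulo \<open>P ^ k\<close>
    with \<open>k > e\<close>; so roots that agree modulo \<open>P ^ Suc e\<close> already agree modulo \<open>P ^ (k - e)\<close>.\<close>
  show ?thesis
  proof (cases "k \<le> e")
    case True
    have "card ?R \<le> card {0..<?P ^ k}" by (intro card_mono) auto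
    also have "\<dots> = p ^ k" by (simp add: nat_power_eq)
    also have "\<dots> \<le> p ^ e" using True prime_ge_1_nat[OF p] by (intro power_increasing) auto
    also have "\<dots> \<le> nat \<bar>D\<bar>" by (rule pe_le)
    also have "\<dots> \<le> nat \<bar>D\<bar> ^ 3" using D(1) by (intro self_le_power) auto
    finally show ?thesis using num by simp
  next
    case False
    have key: "?P ^ (k - e) dvd x - y"
      if xy: "?P ^ k dvd poly f x" "?P ^ k dvd poly f y" "?P ^ Suc e dvd x - y" for x y
    proof (cases "x = y")
      case xny: False
      obtain w where w: "poly f x - poly f y = (x - y) * (poly (pderiv f) y + (x - y) * w)"
        using poly_taylor_first_order .
      define g where "g = poly (pderiv f) y + (x - y) * w"
      obtain s t where st: "D = s * poly f y + t * poly (pderiv f) y" using D(2) by blast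
      have "?P ^ Suc e dvd poly f y"
        using False xy(2) by (meson power_le_dvd not_le Suc_leI)
      then have "\<not> ?P ^ Suc e dvd poly (pderiv f) y"
        using pe(2) st by (metis dvd_add dvd_mult)
      then have ng: "\<not> ?P ^ Suc e dvd g"
        using xy(3) unfolding g_def by (metis dvd_add_left_iff dvd_mult2)
      then have "g \<noteq> 0" by auto
      have "?P ^ k dvd (x - y) * g" using xy w by (metis dvd_diff g_def)
      then have "k \<le> multiplicity ?P ((x - y) * g)"
        using P \<open>g \<noteq> 0\<close> xny by (subst (asm) power_dvd_iff_le_multiplicity) auto
      also have "\<dots> = multiplicity ?P (x - y) + multiplicity ?P g"
        using P \<open>g \<noteq> 0\<close> xny by (intro prime_elem_multiplicity_mult_distrib) auto
      also have "multiplicity ?P g \<le> e"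
        using ng P \<open>g \<noteq> 0\<close> by (subst (asm) power_dvd_iff_le_multiplicity) auto
      finally have "k - e \<le> multiplicity ?P (x - y)" by simp
      then show ?thesis by (rule multiplicity_dvd')
    qed simp
    define T where "T = (if e = 0 then {x \<in> {0..<?P}. ?P dvd poly f x} else {0..<?P ^ Suc e})"
    have finT: "finite T"
      by (rule finite_subset[of _ "{0..<?P} \<union> {0..<?P ^ Suc e}"]) (auto simp: T_def)
    \<comment> \<open>The first component determines a root modulo \<open>P ^ (k - e)\<close> by
      \<open>key\<close>; the quotient, one of \<open>P ^ e\<close> values, then determines it
      completely.\<close>
    let ?\<phi> = "\<lambda>x. (x mod ?P ^ Suc e, x div ?P ^ (k - e))"
    have "inj_on ?\<phi> ?R"
    proof (rule inj_onI)
      fix x y assume xy: "x \<in> ?R" "y \<in> ?R" "?\<phi> x = ?\<phi> y"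
      then have "?P ^ Suc e dvd x - y" by (simp add: mod_eq_dvd_iff)
      then have "?P ^ (k - e) dvd x - y" using key xy by auto
      then have "x mod ?P ^ (k - e) = y mod ?P ^ (k - e)" by (simp add: mod_eq_dvd_iff)
      then show "x = y" using xy(3) by (metis prod.inject mult_div_mod_eq)
    qed
    moreover have "?\<phi> ` ?R \<subseteq> T \<times> {0..<?P ^ e}"
    proof
      fix z assume "z \<in> ?\<phi> ` ?R"
      then obtain x where x: "x \<in> ?R" "z = ?\<phi> x" by blast
      have "x < ?P ^ (k - e) * ?P ^ e" using x False by (simp flip: power_add)
      then have "x div ?P ^ (k - e) < ?P ^ e"
        using P by (intro div_less_of_less_mult) (simp_all add: mult.commute)
      moreover have "x div ?P ^ (k - e) \<ge> 0" using x P by (simp add: pos_imp_zdiv_nonneg_iff)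
      moreover have "x mod ?P ^ Suc e \<in> T"
      proof (cases "e = 0")
        case True
        have "?P dvd poly f x" using x False True dvd_power[of k ?P] by (auto intro: dvd_trans)
        moreover have "?P dvd poly f (x mod ?P) - poly f x"
          using dvd_poly_diff[of "x mod ?P" x f] by (rule dvd_trans[rotated]) (simp add: mod_eq_dvd_iff [symmetric])
        ultimately have "?P dvd poly f (x mod ?P)" by (metis diff_add_cancel dvd_add)
        then show ?thesis using True P by (simp add: T_def)
      qed (use P in \<open>simp add: T_def del: power_Suc\<close>)
      ultimately show "z \<in> T \<times> {0..<?P ^ e}" using x by simp
    qed
    ultimately have "card ?R \<le> card (T \<times> {0..<?P ^ e})"
      by (intro card_inj_on_le) (auto simp: finT)
    also have "\<dots> = card T * p ^ e" by (simp add: card_cartesian_product nat_power_eq)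
    also have "\<dots> \<le> degree f + nat \<bar>D\<bar> ^ 3"
    proof (cases "e = 0")
      case True
      then have "\<not> ?P dvd lead_coeff f" using pe(2) lc by (auto dest: dvd_trans)
      then have "num_roots_mod f p \<le> degree f" using p by (intro num_roots_mod_prime_le)
      then show ?thesis using True by (simp add: T_def num_roots_mod_def)
    next
      case e: False
      \<comment> \<open>Here the count is \<open>p ^ Suc e * p ^ e\<close>, a product of
        \<open>p\<close>, \<open>p ^ e\<close> and \<open>p ^ e\<close>, each at most
        \<open>|D|\<close>.\<close>
      have "p ^ 1 \<le> p ^ e" using e prime_ge_1_nat[OF p] by (intro power_increasing) auto
      then have "p * p ^ e * p ^ e \<le> nat \<bar>D\<bar> * nat \<bar>D\<bar> * nat \<bar>D\<bar>"
        using pe_le by (intro mult_mono) auto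
      then show ?thesis using e by (simp add: T_def nat_mult_distrib nat_power_eq power3_eq_cube)
    qed
    finally show ?thesis using num by simp
  qed
qed

subsection \<open>Values of a polynomial in an interval\<close>

lemma le_div_iff_mult_le_int:
  fixes q m n :: int
  assumes "0 < q"
  shows "m \<le> n div q \<longleftrightarrow> m * q \<le> n"
proof
  assume "m * q \<le> n"
  then have "(m * q) div q \<le> n div q" using assms by (intro zdiv_mono1)
  then show "m \<le> n div q" using assms by simp
next
  assume "m \<le> n div q"
  then show "m * q \<le> n" using div_less_of_less_mult[OF assms, of n m] by linarith
qed

lemma real_of_int_div_bounds:
  "real_of_int (a div b) \<le> real_of_int a / real_of_int b"
  "real_of_int a / real_of_int b - 1 < real_of_int (a div b)"
proof -
  have "\<lfloor>real_of_int a / real_of_int b\<rfloor> = a div b" by (rule floor_divide_of_int_eq)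
  then show "real_of_int (a div b) \<le> real_of_int a / real_of_int b"
    "real_of_int a / real_of_int b - 1 < real_of_int (a div b)" by linarith+
qed

lemma card_congruent_interval:
  fixes u s :: int and K q :: nat
  assumes "q > 0"
  defines "X \<equiv> {x \<in> {u..<u + int K}. int q dvd x - s}"
  shows "real K / real q - 1 \<le> real (card X)" "real (card X) \<le> real K / real q + 1"
proof -
  \<comment> \<open>\<open>a\<close> lies one below the first shifted point, so that the number of
    multiples of \<open>q\<close> is exactly the difference of two floors.\<close>
  define a b where "a = u - 1 - s" and "b = u + int K - 1 - s"
  have q: "int q > 0" using assms(1) by simp
  have "X = (\<lambda>t. s + int q * t) ` {a div int q<..b div int q}"
  proof (intro equalityI subsetI)
    fix x assume x: "x \<in> X"
    then obtain t where t: "x - s = int q * t" by (auto simp: X_def)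
    then have "t \<in> {a div int q<..b div int q}"
      using x q unfolding greaterThanAtMost_iff linorder_not_le[symmetric] le_div_iff_mult_le_int[OF q]
      by (auto simp: X_def a_def b_def mult.commute)
    then show "x \<in> (\<lambda>t. s + int q * t) ` {a div int q<..b div int q}" using t by force
  next
    fix x assume "x \<in> (\<lambda>t. s + int q * t) ` {a div int q<..b div int q}"
    then obtain t where t: "x = s + int q * t" "t \<in> {a div int q<..b div int q}" by blast
    then show "x \<in> X"
      using q unfolding greaterThanAtMost_iff linorder_not_le[symmetric] le_div_iff_mult_le_int[OF q]
      by (auto simp: X_def a_def b_def mult.commute)
  qed
  moreover have "inj_on (\<lambda>t. s + int q * t) A" for A using q by (auto simp: inj_on_def)
  ultimately have "card X = nat (b div int q - a div int q)" by (simp add: card_image)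
  moreover have "a div int q \<le> b div int q" using q by (intro zdiv_mono1) (auto simp: a_def b_def)
  ultimately have card: "real (card X) = real_of_int (b div int q) - real_of_int (a div int q)" by simp
  have "real_of_int b / real q - real_of_int a / real q = real K / real q"
    by (simp add: a_def b_def diff_divide_distrib [symmetric])
  then show "real K / real q - 1 \<le> real (card X)" "real (card X) \<le> real K / real q + 1"
    using real_of_int_div_bounds[of a "int q"] real_of_int_div_bounds[of b "int q"]
    unfolding card by simp_all
qed

section \<open>Prime power divisors of the values of \<open>f\<close>\<close>

lemma card_divisible_values_le:
  assumes "q > 0"
  shows "real (card {n \<in> {1..N}. int q dvd poly f (int n)}) \<le> real (num_roots_mod f q) * (real N / real q + 1)"
proof -
  let ?R = "{r \<in> {0..<int q}. int q dvd poly f r}"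
  let ?X = "\<lambda>r. {x \<in> {1..<1 + int N}. int q dvd x - r}"
  have finR: "finite ?R" by (rule finite_subset[of _ "{0..<int q}"]) auto
  have "int ` {n \<in> {1..N}. int q dvd poly f (int n)} \<subseteq> (\<Union>r\<in>?R. ?X r)"
  proof
    fix x assume "x \<in> int ` {n \<in> {1..N}. int q dvd poly f (int n)}"
    then have x: "x \<in> {1..<1 + int N}" "int q dvd poly f x" by auto
    have d: "int q dvd x - x mod int q" by (simp add: mod_eq_dvd_iff [symmetric])
    then have "int q dvd poly f x - poly f (x mod int q)" using dvd_poly_diff dvd_trans by blast
    then have "int q dvd poly f (x mod int q)" using x(2) by (metis dvd_diff_right_iff)
    then have "x mod int q \<in> ?R" using assms by simp
    then show "x \<in> (\<Union>r\<in>?R. ?X r)" using x(1) d by blast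
  qed
  moreover have "finite (\<Union>r\<in>?R. ?X r)" 
    by (rule finite_subset[of _ "{1..<1 + int N}"]) auto
  ultimately have "card (int ` {n \<in> {1..N}. int q dvd poly f (int n)}) \<le> card (\<Union>r\<in>?R. ?X r)"
    by (rule card_mono[rotated])
  also have "\<dots> \<le> (\<Sum>r\<in>?R. card (?X r))" by (rule card_UN_le[OF finR])
  finally have "real (card {n \<in> {1..N}. int q dvd poly f (int n)}) \<le> (\<Sum>r\<in>?R. real (card (?X r)))"
    by (simp add: card_image flip: of_nat_sum)
  also have "\<dots> \<le> (\<Sum>r\<in>?R. real N / real q + 1)"
    using assms by (intro sum_mono card_congruent_interval)
  finally show ?thesis unfolding num_roots_mod_def by simp
qed

text \<open>The common multiple \<open>L\<close> supplies one finite index set of divisors for all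
  \<open>n\<close>. With \<open>L\<close> the lcm, the sum of \<open>mangoldt\<close> over that set
  is the quantity to be bounded from below.\<close>

lemma ln_sum_values_mangoldt:
  fixes g :: "nat \<Rightarrow> int" and L :: nat
  assumes "L > 0" "\<And>n. n \<in> A \<Longrightarrow> g n dvd int L" "finite A"
  shows "(\<Sum>n\<in>A. ln \<bar>real_of_int (g n)\<bar>) =
    (\<Sum>q | q dvd L. mangoldt q * real (card {n \<in> A. int q dvd g n}))"
proof -
  have finL: "finite {q. q dvd L}" using assms(1) by simp
  have "(\<Sum>n\<in>A. ln \<bar>real_of_int (g n)\<bar>) = (\<Sum>n\<in>A. \<Sum>q | q \<in> {q. q dvd L} \<and> int q dvd g n. mangoldt q)"
  proof (rule sum.cong)
    fix n assume n: "n \<in> A"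
    have "g n \<noteq> 0" using assms(1) assms(2)[OF n] by auto
    have "\<bar>real_of_int (g n)\<bar> = real (nat \<bar>g n\<bar>)" by simp
    then have "ln \<bar>real_of_int (g n)\<bar> = (\<Sum>q | q dvd nat \<bar>g n\<bar>. mangoldt q)"
      using \<open>g n \<noteq> 0\<close> by (subst mangoldt_sum) auto
    also have "{q. q dvd nat \<bar>g n\<bar>} = {q. q \<in> {q. q dvd L} \<and> int q dvd g n}"
    proof -
      have "nat \<bar>g n\<bar> dvd L" using assms(2)[OF n] by (simp flip: int_dvd_int_iff)
      moreover have "q dvd nat \<bar>g n\<bar> \<longleftrightarrow> int q dvd g n" for q by (simp flip: int_dvd_int_iff)
      ultimately show ?thesis using dvd_trans by blast
    qed
    finally show "ln \<bar>real_of_int (g n)\<bar> = (\<Sum>q | q \<in> {q. q dvd L} \<and> int q dvd g n. mangoldt q)" .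
  qed simp
  also have "\<dots> = (\<Sum>q | q dvd L. \<Sum>n | n \<in> A \<and> int q dvd g n. mangoldt q)"
    using sum.swap_restrict[OF assms(3) finL] .
  also have "\<dots> = (\<Sum>q | q dvd L. mangoldt q * real (card {n \<in> A. int q dvd g n}))"
    by (simp add: mult.commute)
  finally show ?thesis .
qed

text \<open>This is S(N).\<close>

definition root_mertens_sum :: "int poly \<Rightarrow> nat \<Rightarrow> real" where
  "root_mertens_sum f N = (\<Sum>p | prime p \<and> p \<le> N. real (num_roots_mod f p) * (ln (real p) / real p))"

lemma ln_sum_values_le:
  assumes C: "\<And>p k. prime p \<Longrightarrow> num_roots_mod f (p ^ k) \<le> C"
    and L: "L > 0" "\<And>n. n \<in> {1..N} \<Longrightarrow> poly f (int n) dvd int L"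
  shows "(\<Sum>n\<in>{1..N}. ln \<bar>real_of_int (poly f (int n))\<bar>) \<le>
     real N * (root_mertens_sum f N + 4 * real C) + 2 * real C * ln (real L)"
proof -
  let ?A = "\<lambda>q. {n \<in> {1..N}. int q dvd poly f (int n)}"
  let ?h = "\<lambda>q. mangoldt q * real (num_roots_mod f q) / real q"
  have rho: "mangoldt q * real (num_roots_mod f q) \<le> mangoldt q * real C" for q
  proof (cases "primepow q")
    case True
    then obtain p k where "prime p" "q = p ^ k" by (auto simp: primepow_def)
    then show ?thesis using C by (intro mult_left_mono) (auto simp: mangoldt_nonneg)
  qed (simp add: mangoldt_def)
  have "(\<Sum>n\<in>{1..N}. ln \<bar>real_of_int (poly f (int n))\<bar>) = (\<Sum>q | q dvd L. mangoldt q * real (card (?A q)))"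
    by (rule ln_sum_values_mangoldt) (use L in auto)
  \<comment> \<open>For \<open>q <= N\<close> the main part \<open>N / q\<close> is kept and the
    rounding error costs at most \<open>C\<close>; for \<open>q > N\<close> the whole factor
    \<open>N / q + 1\<close> is at most 2. Summed over \<open>q dvd L\<close>, these costs stay
    below \<open>2 * C * ln L\<close>.\<close>
  also have "\<dots> \<le> (\<Sum>q | q dvd L. (if q \<in> {1..N} then real N * ?h q else 0) + 2 * real C * mangoldt q)"
  proof (rule sum_mono)
    fix q assume "q \<in> {q. q dvd L}"
    then have q: "q > 0" using L(1) by (auto intro: Nat.gr0I)
    have le: "mangoldt q * real (card (?A q)) \<le> mangoldt q * (real (num_roots_mod f q) * (real N / real q + 1))"
      using card_divisible_values_le[OF q] by (intro mult_left_mono) (auto simp: mangoldt_nonneg)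
    show "mangoldt q * real (card (?A q)) \<le> (if q \<in> {1..N} then real N * ?h q else 0) + 2 * real C * mangoldt q"
    proof (cases "q \<le> N")
      case True
      have "0 \<le> mangoldt q * real C" by (simp add: mangoldt_nonneg)
      then show ?thesis using le rho[of q] q True by (simp add: algebra_simps)
    next
      case False
      then have "real N / real q \<le> 1" using q by simp
      then have "mangoldt q * (real (num_roots_mod f q) * (real N / real q + 1)) \<le> mangoldt q * (real (num_roots_mod f q) * 2)"
        by (intro mult_left_mono) (auto simp: mangoldt_nonneg)
      then show ?thesis using le rho[of q] False by (simp add: algebra_simps)
    qed
  qed
  also have "\<dots> = (\<Sum>q | q dvd L. if q \<in> {1..N} then real N * ?h q else 0) + 2 * real C * ln (real L)"
    using mangoldt_sum[of L, where ?'a = real] L(1) by (simp add: sum.distrib sum_distrib_left [symmetric])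
  also have "(\<Sum>q | q dvd L. if q \<in> {1..N} then real N * ?h q else 0) \<le> (\<Sum>q\<in>{1..N}. real N * ?h q)"
    using L(1) by (subst sum.inter_restrict [symmetric]) (auto intro!: sum_mono2 simp: mangoldt_nonneg)
  also have "\<dots> = real N * (\<Sum>q\<in>{1..N}. ?h q)" by (simp add: sum_distrib_left)
  \<comment> \<open>Primes give S(N); proper prime powers cost at most \<open>4 * C\<close>, by the
    uniform bound on rho.\<close>
  also have "(\<Sum>q\<in>{1..N}. ?h q) \<le> root_mertens_sum f N + 4 * real C"
  proof -
    have split: "{1..N} = {p. prime p \<and> p \<le> N} \<union> {q\<in>{1..N}. \<not> prime q}"
      by (auto simp: Suc_le_eq prime_gt_0_nat)
    have "(\<Sum>q\<in>{1..N}. ?h q) = (\<Sum>q | prime q \<and> q \<le> N. ?h q) + (\<Sum>q | q \<in> {1..N} \<and> \<not> prime q. ?h q)"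
      by (subst split, rule sum.union_disjoint) auto
    also have "(\<Sum>q | prime q \<and> q \<le> N. ?h q) = root_mertens_sum f N"
      unfolding root_mertens_sum_def by (intro sum.cong) auto
    also have "(\<Sum>q | q \<in> {1..N} \<and> \<not> prime q. ?h q) \<le> (\<Sum>q | q \<in> {1..N} \<and> \<not> prime q. real C * (mangoldt q / real q))"
      using rho by (intro sum_mono) (simp add: divide_right_mono mult.commute)
    also have "\<dots> = real C * (\<Sum>q | q \<in> {1..N} \<and> \<not> prime q. mangoldt q / real q)"
      by (simp add: sum_distrib_left)
    also have "\<dots> \<le> real C * 4" by (intro mult_left_mono sum_mangoldt_nonprime_le) auto
    finally show ?thesis by simp
  qed
  finally show ?thesis by (simp add: mult_left_mono)
qed

section \<open>Lower bound for the product of the values\<close>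

lemma poly_value_lower_bound:
  fixes f :: "int poly"
  assumes nz: "\<And>n::nat. poly f (int n) \<noteq> 0" and deg: "degree f > 0"
  obtains c :: real where "c > 0" "\<And>n::nat. c * real n ^ degree f \<le> \<bar>real_of_int (poly f (int n))\<bar>"
proof -
  define d where "d = degree f"
  define A where "A = (\<Sum>i<d. \<bar>real_of_int (coeff f i)\<bar>)"
  have A: "A \<ge> 0" by (simp add: A_def sum_nonneg)
  \<comment> \<open>Up to \<open>2 * A + 1\<close> this makes \<open>c * n ^ d\<close> at most
    \<open>1 / 2\<close>, while a nonzero integer has absolute value at least 1. Beyond it the
    leading term exceeds twice the rest, so any \<open>c <= 1 / 2\<close> works.\<close>
  define c where "c = 1 / (2 * (2 * A + 1) ^ d)"
  have big: "(2 * A + 1) ^ d \<ge> 1" using A by (intro one_le_power) auto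
  have c: "c > 0" "c \<le> 1 / 2" using big by (auto simp: c_def divide_simps)
  show ?thesis
  proof (rule that[OF c(1)])
    fix n :: nat
    have "1 \<le> \<bar>poly f (int n)\<bar>" using nz[of n] by linarith
    then have one: "1 \<le> \<bar>real_of_int (poly f (int n))\<bar>" by linarith
    show "c * real n ^ degree f \<le> \<bar>real_of_int (poly f (int n))\<bar>"
    proof (cases "real n \<le> 2 * A + 1")
      case True
      then have "real n ^ d \<le> (2 * A + 1) ^ d" by (intro power_mono) auto
      then have "c * real n ^ d \<le> c * (2 * A + 1) ^ d" using c by (intro mult_left_mono) auto
      also have "\<dots> \<le> 1" using big by (simp add: c_def)
      finally show ?thesis using one by (simp add: d_def)
    next
      case False
      then have n: "real n > 2 * A" "real n \<ge> 1" using A by auto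
      have "coeff f d \<noteq> 0" using deg by (auto simp: d_def)
      then have "1 \<le> \<bar>coeff f d\<bar>" by linarith
      then have lc: "1 \<le> \<bar>real_of_int (coeff f d)\<bar>" by linarith
      have "real_of_int (poly f (int n)) = (\<Sum>i<d. real_of_int (coeff f i) * real n ^ i) + real_of_int (coeff f d) * real n ^ d"
        unfolding poly_altdef d_def [symmetric] by (simp add: lessThan_Suc_atMost [symmetric])
      moreover have "\<bar>\<Sum>i<d. real_of_int (coeff f i) * real n ^ i\<bar> \<le> real n ^ d / 2"
      proof -
        have "\<bar>\<Sum>i<d. real_of_int (coeff f i) * real n ^ i\<bar> \<le> (\<Sum>i<d. \<bar>real_of_int (coeff f i)\<bar> * real n ^ (d - 1))"
          using n by (intro order_trans[OF sum_abs] sum_mono)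
             (auto simp: abs_mult intro!: mult_left_mono power_increasing)
        also have "\<dots> = A * real n ^ (d - 1)" by (simp add: A_def sum_distrib_right)
        also have "\<dots> \<le> (real n / 2) * real n ^ (d - 1)" using n by (intro mult_right_mono) auto
        also have "\<dots> = real n ^ d / 2" using deg by (cases d) (auto simp: d_def)
        finally show ?thesis .
      qed
      moreover have "real n ^ d \<le> \<bar>real_of_int (coeff f d) * real n ^ d\<bar>"
        using mult_right_mono[OF lc, of "real n ^ d"] by (simp add: abs_mult)
      ultimately have "1 / 2 * real n ^ d \<le> \<bar>real_of_int (poly f (int n))\<bar>" by linarith
      moreover have "c * real n ^ d \<le> 1 / 2 * real n ^ d" using c by (intro mult_right_mono) auto
      ultimately show ?thesis by (simp add: d_def)
    qed
  qed
qed

lemma ln_sum_values_ge: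
  fixes f :: "int poly"
  assumes nz: "\<And>n::nat. poly f (int n) \<noteq> 0" and deg: "degree f > 0"
  obtains K :: real where "\<And>N. real (degree f) * real N * ln (real N) - K * real N \<le>
    (\<Sum>n\<in>{1..N}. ln \<bar>real_of_int (poly f (int n))\<bar>)"
proof -
  obtain c where c: "c > 0" "\<And>n::nat. c * real n ^ degree f \<le> \<bar>real_of_int (poly f (int n))\<bar>"
    using poly_value_lower_bound[OF assms] by blast
  show ?thesis
  \<comment> \<open>Summing \<open>ln (c * n ^ d)\<close> gives
    \<open>N * ln c + d * ln (fact N)\<close>, and the factorial bound loses another
    \<open>d * N\<close>.\<close>
  proof (rule that[of "real (degree f) - ln c"])
    fix N :: nat
    have "real N * ln c + real (degree f) * ln (fact N) = (\<Sum>n\<in>{1..N}. ln (c * real n ^ degree f))"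
      using c(1) by (simp add: ln_fact_eq_sum ln_mult ln_realpow sum.distrib sum_distrib_left)
    also have "\<dots> \<le> (\<Sum>n\<in>{1..N}. ln \<bar>real_of_int (poly f (int n))\<bar>)"
      using c by (intro sum_mono ln_mono) auto
    finally show "real (degree f) * real N * ln (real N) - (real (degree f) - ln c) * real N \<le>
        (\<Sum>n\<in>{1..N}. ln \<bar>real_of_int (poly f (int n))\<bar>)"
      using mult_left_mono[OF ln_fact_ge[of N], of "real (degree f)"] by (simp add: algebra_simps)
  qed
qed

subsection \<open>The homogenization on a box\<close>

text \<open>The binary form \<open>b^d f(a/b)\<close>, written so that \<open>b = 0\<close> is
  allowed.\<close>

definition homogenization :: "int poly \<Rightarrow> int \<Rightarrow> int \<Rightarrow> int" where
  "homogenization f a b = (\<Sum>i\<le>degree f. coeff f i * a ^ i * b ^ (degree f - i))"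

lemma homogenization_mult: "homogenization f (r * b) b = b ^ degree f * poly f r"
proof -
  have "coeff f i * (r * b) ^ i * b ^ (degree f - i) = b ^ degree f * (coeff f i * r ^ i)"
    if "i \<le> degree f" for i
  proof -
    have "b ^ degree f = b ^ i * b ^ (degree f - i)" using that by (simp flip: power_add)
    then show ?thesis by (simp add: power_mult_distrib)
  qed
  then show ?thesis unfolding homogenization_def poly_altdef sum_distrib_left by (intro sum.cong) auto
qed

text \<open>Modulo \<open>m\<close> the value reduces to that at \<open>(r * b, b)\<close>, which is
  \<open>b^d f(r)\<close>. Each root modulo \<open>m\<close> thus yields a lattice of index
  \<open>m\<close> on which the form is divisible by \<open>m\<close>.\<close>

lemma dvd_homogenization:
  assumes "m dvd poly f r" "m dvd a - r * b"
  shows "m dvd homogenization f a b"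
proof -
  have "[a = r * b] (mod m)" using assms(2) by (simp add: cong_iff_dvd_diff)
  then have "[homogenization f a b = homogenization f (r * b) b] (mod m)"
    unfolding homogenization_def by (intro cong_sum cong_mult cong_pow cong_refl)
  moreover have "m dvd homogenization f (r * b) b" using assms(1) by (simp add: homogenization_mult)
  ultimately show ?thesis using cong_dvd_iff by blast
qed

lemma irreducible_poly_no_root:
  fixes F :: "'a :: field poly"
  assumes "irreducible F" "degree F \<ge> 2"
  shows "poly F x \<noteq> 0"
proof
  assume "poly F x = 0"
  then obtain G where G: "F = [:-x, 1:] * G" by (auto simp: poly_eq_0_iff_dvd elim: dvdE)
  then have "G \<noteq> 0" using assms by auto
  then have "degree F = degree [:-x, 1:] + degree G" unfolding G by (intro degree_mult_eq) auto
  then have "degree G \<ge> 1" using assms(2) by simp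
  moreover have "is_unit [:-x, 1:] \<or> is_unit G" using irreducibleD[OF assms(1) G] .
  ultimately show False by (auto simp: is_unit_iff_degree \<open>G \<noteq> 0\<close>)
qed

text \<open>For \<open>b = 0\<close> only the leading term survives; otherwise a zero would make
  \<open>a / b\<close> a rational root. So every value on the punctured box has a usable
  logarithm.\<close>

lemma homogenization_nonzero:
  assumes irr: "irreducible (map_poly of_int f :: rat poly)" and deg: "degree f \<ge> 2"
    and ab: "(a, b) \<noteq> (0, 0)"
  shows "homogenization f a b \<noteq> 0"
proof (cases "b = 0")
  case True
  then have "homogenization f a b = (\<Sum>i\<in>{degree f}. coeff f i * a ^ i * b ^ (degree f - i))"
    unfolding homogenization_def by (intro sum.mono_neutral_right) (auto simp: le_less)
  then show ?thesis using True ab deg by auto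
next
  case False
  define F :: "rat poly" where "F = map_poly of_int f"
  let ?a = "rat_of_int a" and ?b = "rat_of_int b"
  have degF: "degree F = degree f" by (simp add: F_def degree_map_poly)
  have "?b ^ degree f * poly F (?a / ?b) = rat_of_int (homogenization f a b)"
    unfolding homogenization_def poly_altdef degF sum_distrib_left of_int_sum
  proof (intro sum.cong refl)
    fix i assume "i \<in> {..degree f}"
    then have "?b ^ degree f = ?b ^ i * ?b ^ (degree f - i)" by (simp flip: power_add)
    then show "?b ^ degree f * (coeff F i * (?a / ?b) ^ i) = of_int (coeff f i * a ^ i * b ^ (degree f - i))"
      using False by (simp add: F_def coeff_map_poly power_divide)
  qed
  moreover have "poly F (?a / ?b) \<noteq> 0"
    using irreducible_poly_no_root[of F] irr deg degF by (simp add: F_def)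
  ultimately show ?thesis using False by auto
qed

lemma homogenization_abs_le:
  assumes "\<bar>a\<bar> \<le> int H" "\<bar>b\<bar> \<le> int H"
  shows "\<bar>homogenization f a b\<bar> \<le> (\<Sum>i\<le>degree f. \<bar>coeff f i\<bar>) * int H ^ degree f"
proof -
  have "\<bar>homogenization f a b\<bar> \<le> (\<Sum>i\<le>degree f. \<bar>coeff f i * a ^ i * b ^ (degree f - i)\<bar>)"
    unfolding homogenization_def by (rule sum_abs)
  also have "\<dots> \<le> (\<Sum>i\<le>degree f. \<bar>coeff f i\<bar> * int H ^ degree f)"
  proof (rule sum_mono)
    fix i assume i: "i \<in> {..degree f}"
    have "\<bar>a\<bar> ^ i * \<bar>b\<bar> ^ (degree f - i) \<le> int H ^ i * int H ^ (degree f - i)"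
      using assms by (intro mult_mono power_mono) auto
    also have "\<dots> = int H ^ degree f" using i by (simp flip: power_add)
    finally show "\<bar>coeff f i * a ^ i * b ^ (degree f - i)\<bar> \<le> \<bar>coeff f i\<bar> * int H ^ degree f"
      by (simp add: abs_mult power_abs mult.assoc mult_left_mono)
  qed
  finally show ?thesis by (simp add: sum_distrib_right)
qed

section \<open>Points of the box at which a prime divides the form\<close>

definition punctured_box :: "nat \<Rightarrow> (int \<times> int) set" where
  "punctured_box H = {- int H..int H} \<times> {- int H..int H} - {(0, 0)}"

definition num_box_multiples :: "int poly \<Rightarrow> nat \<Rightarrow> nat \<Rightarrow> nat" where
  "num_box_multiples f H p = card {v \<in> punctured_box H. int p dvd homogenization f (fst v) (snd v)}"

lemma finite_punctured_box [simp]: "finite (punctured_box H)"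
  by (simp add: punctured_box_def)

text \<open>The lattices of two distinct roots meet only where \<open>p\<close> divides
  \<open>b\<close>; this prevents double counting over the roots.\<close>

lemma roots_mod_eqI:
  assumes p: "prime p" "\<not> int p dvd b"
    and r: "r \<in> {0..<int p}" "r' \<in> {0..<int p}" "int p dvd a - r * b" "int p dvd a - r' * b"
  shows "r = r'"
proof -
  have "int p dvd (a - r' * b) - (a - r * b)" by (rule dvd_diff[OF r(4) r(3)])
  then have "int p dvd (r - r') * b" by (simp add: algebra_simps)
  then have "int p dvd r - r'" using p by (simp add: prime_dvd_mult_iff)
  then show ?thesis using r by (auto simp: mod_eq_dvd_iff [symmetric])
qed

text \<open>For each root and each \<open>b\<close> prime to \<open>p\<close>, the admissible
  \<open>a\<close> form a residue class, with at least \<open>K / p - 1\<close> members in the box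
  of side \<open>K\<close>. Restricting to such \<open>b\<close> avoids the origin and lets
  \<open>(a, b)\<close> determine the root.\<close>

lemma num_box_multiples_small:
  fixes H p :: nat
  assumes p: "prime p" "p \<le> H"
  defines "K \<equiv> 2 * real H + 1"
  shows "real (num_roots_mod f p) * (K\<^sup>2 / real p - K\<^sup>2 / real p ^ 2 - K) \<le> real (num_box_multiples f H p)"
proof -
  let ?I = "{- int H..int H}"
  have I: "?I = {- int H..<- int H + int (2 * H + 1)}" by auto
  have p0: "p > 0" using p prime_gt_0_nat by blast
  define R where "R = {r \<in> {0..<int p}. int p dvd poly f r}"
  define B where "B = {b \<in> ?I. \<not> int p dvd b}"
  define A where "A = (\<lambda>r b. {a \<in> ?I. int p dvd a - r * b})"
  have fin: "finite R" "finite B" "finite (A r b)" for r b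
    by (auto simp: R_def B_def A_def intro: finite_subset[of _ "{0..<int p}"] finite_subset[of _ ?I])
  have cA: "K / real p - 1 \<le> real (card (A r b))" for r b
    using card_congruent_interval(1)[OF p0, of "2 * H + 1" "- int H" "r * b"]
    unfolding A_def I K_def by (simp add: add.commute)
  have cB: "K - K / real p - 1 \<le> real (card B)"
  proof -
    have "real (card {b \<in> ?I. int p dvd b}) \<le> K / real p + 1"
      using card_congruent_interval(2)[OF p0, of "- int H" "2 * H + 1" 0] unfolding I K_def by (simp add: add.commute)
    moreover have "finite {b \<in> ?I. int p dvd b}" by (rule finite_subset[of _ ?I]) auto
    then have "card (?I - {b \<in> ?I. int p dvd b}) = card ?I - card {b \<in> ?I. int p dvd b}"
      by (rule card_Diff_subset) auto
    moreover have "?I - {b \<in> ?I. int p dvd b} = B" by (auto simp: B_def)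
    moreover have "card {b \<in> ?I. int p dvd b} \<le> card ?I" by (intro card_mono) auto
    ultimately show ?thesis by (simp add: K_def of_nat_diff)
  qed
  have Kp: "K / real p - 1 \<ge> 0" using p p0 by (simp add: K_def field_simps)
  define S where "S = (SIGMA r:R. SIGMA b:B. A r b)"
  let ?g = "\<lambda>(r, b, a). (a, b)"
  have "inj_on ?g S"
    using roots_mod_eqI[OF p(1)] by (auto simp: inj_on_def S_def R_def B_def A_def)
  moreover have "?g ` S \<subseteq> {v \<in> punctured_box H. int p dvd homogenization f (fst v) (snd v)}"
    by (auto simp: S_def R_def B_def A_def punctured_box_def intro: dvd_homogenization)
  ultimately have "card S \<le> num_box_multiples f H p"
    unfolding num_box_multiples_def by (intro card_inj_on_le) auto
  moreover have "real (card R) * (real (card B) * (K / real p - 1)) \<le> real (card S)"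
  proof -
    have "real (card S) = (\<Sum>r\<in>R. \<Sum>b\<in>B. real (card (A r b)))"
      unfolding S_def using fin by (simp add: card_SigmaI)
    also have "\<dots> \<ge> (\<Sum>r\<in>R. \<Sum>b\<in>B. K / real p - 1)" by (intro sum_mono cA)
    finally show ?thesis by simp
  qed
  moreover have "K\<^sup>2 / real p - K\<^sup>2 / real p ^ 2 - K \<le> real (card B) * (K / real p - 1)"
  proof -
    \<comment> \<open>The right-hand product expands to the left-hand side plus 1.\<close>
    have "K\<^sup>2 / real p - K\<^sup>2 / real p ^ 2 - K \<le> (K - K / real p - 1) * (K / real p - 1)"
      using p0 by (simp add: field_simps power2_eq_square)
    also have "\<dots> \<le> real (card B) * (K / real p - 1)" using cB Kp by (intro mult_right_mono)
    finally show ?thesis .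
  qed
  ultimately show ?thesis
    using mult_left_mono[of "K\<^sup>2 / real p - K\<^sup>2 / real p ^ 2 - K" "real (card B) * (K / real p - 1)" "real (card R)"]
    unfolding num_roots_mod_def R_def [symmetric] by linarith
qed

lemma pigeonhole_average:
  assumes "finite A" "finite Y" "Y \<noteq> {}" "\<phi> ` A \<subseteq> Y"
  shows "\<exists>y\<in>Y. real (card A) / real (card Y) \<le> real (card {x \<in> A. \<phi> x = y})"
proof (rule ccontr)
  assume "\<not> ?thesis"
  then have lt: "real (card {x \<in> A. \<phi> x = y}) < real (card A) / real (card Y)" if "y \<in> Y" for y
    using that by (simp add: not_le)
  have "real (card A) = (\<Sum>y\<in>Y. real (card {x \<in> A. \<phi> x = y}))"
    using sum.group[OF assms(1,2,4), of "\<lambda>_. 1 :: nat"] by (simp flip: of_nat_sum)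
  also have "\<dots> < (\<Sum>y\<in>Y. real (card A) / real (card Y))"
    using assms lt by (intro sum_strict_mono) auto
  finally show False using assms by simp
qed

text \<open>Some class modulo the lattice \<open>a \<equiv> r b (mod p)\<close> contains at least \<open>H\<^sup>2 / p\<close> of the points
  of \<open>{1..H}\<^sup>2\<close>, and their differences with one of them are lattice points in the box.\<close>

lemma num_box_multiples_large:
  assumes p: "prime p" "H < p" "2 * p \<le> H\<^sup>2"
  shows "real (num_roots_mod f p) * (real H ^ 2 / (2 * real p)) \<le> real (num_box_multiples f H p)"
proof -
  have p0: "p > 0" using p prime_gt_0_nat by blast
  define R where "R = {r \<in> {0..<int p}. int p dvd poly f r}"
  define V where "V = (\<lambda>r. {v \<in> punctured_box H. int p dvd fst v - r * snd v})"
  have finR: "finite R" by (rule finite_subset[of _ "{0..<int p}"]) (auto simp: R_def)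
  have finV: "finite (V r)" for r by (simp add: V_def)
  \<comment> \<open>As \<open>p > H\<close>, a coordinate divisible by \<open>p\<close> is 0; hence
    lattices of distinct roots are disjoint in the punctured box.\<close>
  have small: "x = 0" if "int p dvd x" "\<bar>x\<bar> \<le> int H" for x
    using dvd_imp_le_int[of x "int p"] that p(2) by auto
  have disj: "V r \<inter> V r' = {}" if "r \<in> R" "r' \<in> R" "r \<noteq> r'" for r r'
  proof (rule ccontr)
    assume "V r \<inter> V r' \<noteq> {}"
    then obtain a b where ab: "(a, b) \<in> punctured_box H" "int p dvd a - r * b" "int p dvd a - r' * b"
      by (auto simp: V_def)
    then have "int p dvd b" using roots_mod_eqI[OF p(1), of b r r' a] that by (auto simp: R_def)
    moreover have "\<bar>b\<bar> \<le> int H" "\<bar>a\<bar> \<le> int H" using ab(1) by (auto simp: punctured_box_def)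
    ultimately have "b = 0" "a = 0" using small[of b] small[of a] ab(2) by simp_all
    then show False using \<open>b = 0\<close> ab(1) by (simp add: punctured_box_def)
  qed
  have cV: "real H ^ 2 / (2 * real p) \<le> real (card (V r))" for r
  proof -
    let ?Q = "{1..int H} \<times> {1..int H}"
    let ?\<phi> = "\<lambda>v. (fst v - r * snd v) mod int p"
    have "\<exists>y\<in>{0..<int p}. real (card ?Q) / real (card {0..<int p}) \<le> real (card {v \<in> ?Q. ?\<phi> v = y})"
      by (rule pigeonhole_average) (use p0 in auto)
    then obtain y where "real (card ?Q) / real (card {0..<int p}) \<le> real (card {v \<in> ?Q. ?\<phi> v = y})"
      by blast
    then have y: "real H ^ 2 / real p \<le> real (card {v \<in> ?Q. ?\<phi> v = y})"
      by (simp add: card_cartesian_product power2_eq_square)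
    define E where "E = {v \<in> ?Q. ?\<phi> v = y}"
    \<comment> \<open>With \<open>H^2 / p >= 2\<close>, losing the base point \<open>w\<close> costs
      at most half of the bound \<open>H^2 / p\<close>.\<close>
    have "2 * real p \<le> real H ^ 2" using p(3) by (metis of_nat_le_iff of_nat_mult of_nat_numeral of_nat_power)
    then have two: "2 \<le> real H ^ 2 / real p" using p0 by (simp add: field_simps)
    then have "card E \<noteq> 0" using y unfolding E_def by linarith
    then obtain w where w: "w \<in> E" by (metis card.empty ex_in_conv)
    have finE: "finite E" by (rule finite_subset[of _ ?Q]) (auto simp: E_def)
    have "(\<lambda>v. (fst v - fst w, snd v - snd w)) ` (E - {w}) \<subseteq> V r"
    proof
      fix u assume "u \<in> (\<lambda>v. (fst v - fst w, snd v - snd w)) ` (E - {w})"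
      then obtain v where v: "v \<in> E" "v \<noteq> w" "u = (fst v - fst w, snd v - snd w)" by blast
      have "int p dvd (fst v - r * snd v) - (fst w - r * snd w)"
        using v(1) w by (simp add: E_def mod_eq_dvd_iff [symmetric])
      moreover have "u \<in> punctured_box H"
        using v(1,2) w unfolding v(3) by (auto simp: punctured_box_def E_def prod_eq_iff)
      ultimately show "u \<in> V r" using v(3) by (simp add: V_def algebra_simps)
    qed
    moreover have "inj_on (\<lambda>v. (fst v - fst w, snd v - snd w)) (E - {w})"
      by (auto simp: inj_on_def prod_eq_iff)
    ultimately have "card (E - {w}) \<le> card (V r)" using finV by (intro card_inj_on_le)
    then have "real (card E) - 1 \<le> real (card (V r))" using w finE by simp
    then show ?thesis using y two unfolding E_def by (simp add: field_simps)
  qed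
  have "real (card R) * (real H ^ 2 / (2 * real p)) = (\<Sum>r\<in>R. real H ^ 2 / (2 * real p))" by simp
  also have "\<dots> \<le> (\<Sum>r\<in>R. real (card (V r)))" by (intro sum_mono cV)
  also have "\<dots> = real (card (\<Union>r\<in>R. V r))"
    using finR finV disj by (subst card_UN_disjoint) auto
  also have "\<dots> \<le> real (num_box_multiples f H p)"
    unfolding num_box_multiples_def of_nat_le_iff
    by (intro card_mono) (auto simp: V_def R_def intro: dvd_homogenization)
  finally show ?thesis unfolding num_roots_mod_def R_def .
qed

subsection \<open>Mertens sums weighted by numbers of roots\<close>

text \<open>Count pairs of a prime \<open>p <= N\<close> and a box point whose form value it
  divides, with weight \<open>ln p\<close>. By points, each contributes at most the logarithm of the
  form value; by primes, the two lattice counts bound the sum from below. Divide by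
  \<open>K^2\<close>.\<close>

lemma box_inequality:
  fixes f :: "int poly"
  assumes irr: "irreducible (map_poly of_int f :: rat poly)" and deg: "degree f \<ge> 2"
    and C: "\<And>p. prime p \<Longrightarrow> num_roots_mod f p \<le> C"
  obtains C1 :: real where "\<And>H N. 1 \<le> H \<Longrightarrow> H \<le> N \<Longrightarrow> 2 * N \<le> H\<^sup>2 \<Longrightarrow>
    root_mertens_sum f H + (root_mertens_sum f N - root_mertens_sum f H) / 18
      \<le> real (degree f) * ln (real H) + C1"
proof -
  define s where "s = (\<Sum>i\<le>degree f. \<bar>coeff f i\<bar>)"
  have "\<bar>coeff f (degree f)\<bar> \<le> s" unfolding s_def by (rule member_le_sum) auto
  moreover have "coeff f (degree f) \<noteq> 0" using deg by auto
  ultimately have s: "s \<ge> 1" by linarith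
  show ?thesis
  \<comment> \<open>\<open>s\<close> bounds the coefficients of the form. Of the
    \<open>3 * C\<close>, the sum of \<open>ln p / p^2\<close> accounts for \<open>2 * C\<close>,
    and Chebyshev's bound up to \<open>H\<close> for \<open>C\<close>.\<close>
  proof (rule that[of "ln (real_of_int s) + 3 * real C"])
    fix H N :: nat
    assume H: "1 \<le> H" "H \<le> N" "2 * N \<le> H\<^sup>2"
    define K where "K = 2 * real H + 1"
    have K: "K > 0" "K \<le> 3 * real H" using H by (auto simp: K_def)
    let ?h = "\<lambda>v. homogenization f (fst v) (snd v)"
    let ?w = "\<lambda>p. real (num_roots_mod f p) * (ln (real p) / real p)"
    define P where "P = {p. prime p \<and> p \<le> N}"
    define P1 where "P1 = {p. prime p \<and> p \<le> H}"
    define P2 where "P2 = {p. prime p \<and> H < p \<and> p \<le> N}"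
    have fin: "finite P" "finite P1" "finite P2" by (auto simp: P_def P1_def P2_def)
    have P: "P = P1 \<union> P2" "P1 \<inter> P2 = {}" using H by (auto simp: P_def P1_def P2_def)
    have diff: "root_mertens_sum f N - root_mertens_sum f H = (\<Sum>p\<in>P2. ?w p)"
      unfolding root_mertens_sum_def P_def[symmetric] P1_def[symmetric] P(1)
      using fin P by (subst sum.union_disjoint) auto
    have "(\<Sum>p\<in>P. ln (real p) * real (num_box_multiples f H p))
        = (\<Sum>p\<in>P. \<Sum>v | v \<in> punctured_box H \<and> int p dvd ?h v. ln (real p))"
      by (simp add: num_box_multiples_def mult.commute)
    also have "\<dots> = (\<Sum>v\<in>punctured_box H. \<Sum>p | p \<in> P \<and> int p dvd ?h v. ln (real p))"
      by (rule sum.swap_restrict [symmetric]) (auto simp: fin)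
    also have "\<dots> \<le> (\<Sum>v\<in>punctured_box H. ln (real_of_int s) + real (degree f) * ln (real H))"
    proof (rule sum_mono)
      fix v assume v: "v \<in> punctured_box H"
      then have nz: "?h v \<noteq> 0"
        using homogenization_nonzero[OF irr deg, of "fst v" "snd v"] by (auto simp: punctured_box_def)
      have "(\<Sum>p | p \<in> P \<and> int p dvd ?h v. ln (real p)) \<le> ln (real (nat \<bar>?h v\<bar>))"
        using nz by (intro sum_ln_prime_divisors_le) (auto simp: P_def simp flip: int_dvd_int_iff)
      also have "\<dots> \<le> ln (real_of_int (s * int H ^ degree f))"
      proof -
        have "\<bar>?h v\<bar> \<le> s * int H ^ degree f"
          unfolding s_def using v by (intro homogenization_abs_le) (auto simp: punctured_box_def)
        then have "real_of_int \<bar>?h v\<bar> \<le> real_of_int (s * int H ^ degree f)" by (simp only: of_int_le_iff)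
        then show ?thesis using nz by (intro ln_mono) auto
      qed
      also have "\<dots> = ln (real_of_int s) + real (degree f) * ln (real H)"
        using s H by (simp add: ln_mult ln_realpow)
      finally show "(\<Sum>p | p \<in> P \<and> int p dvd ?h v. ln (real p)) \<le> ln (real_of_int s) + real (degree f) * ln (real H)" .
    qed
    also have "\<dots> \<le> K\<^sup>2 * (ln (real_of_int s) + real (degree f) * ln (real H))"
    proof -
      have "card (punctured_box H) \<le> card ({- int H..int H} \<times> {- int H..int H})"
        by (intro card_mono) (auto simp: punctured_box_def)
      also have "\<dots> = (2 * H + 1) ^ 2"
        by (simp add: card_cartesian_product power2_eq_square nat_add_distrib nat_mult_distrib)
      finally have "real (card (punctured_box H)) \<le> real ((2 * H + 1) ^ 2)" by (simp only: of_nat_le_iff)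
      then have "real (card (punctured_box H)) \<le> K\<^sup>2" by (simp add: K_def add.commute)
      then show ?thesis using s H by (simp add: mult_right_mono)
    qed
    finally have upper: "(\<Sum>p\<in>P. ln (real p) * real (num_box_multiples f H p)) \<le>
      K\<^sup>2 * (ln (real_of_int s) + real (degree f) * ln (real H))" .
    have low1: "K\<^sup>2 * (root_mertens_sum f H - 3 * real C) \<le> (\<Sum>p\<in>P1. ln (real p) * real (num_box_multiples f H p))"
    proof -
      have "K\<^sup>2 * root_mertens_sum f H - real C * (K\<^sup>2 * (\<Sum>p\<in>P1. ln (real p) / real p ^ 2)) - real C * (K * (\<Sum>p\<in>P1. ln (real p)))
        = (\<Sum>p\<in>P1. K\<^sup>2 * ?w p - real C * (K\<^sup>2 * (ln (real p) / real p ^ 2)) - real C * (K * ln (real p)))"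
        unfolding root_mertens_sum_def P1_def[symmetric] by (simp add: sum_subtractf sum_distrib_left)
      also have "\<dots> \<le> (\<Sum>p\<in>P1. ln (real p) * real (num_box_multiples f H p))"
      proof (rule sum_mono)
        fix p assume "p \<in> P1"
        then have p: "prime p" "p \<le> H" by (auto simp: P1_def)
        have ln: "ln (real p) \<ge> 0" using p ln_prime_nonneg by blast
        \<comment> \<open>Only in the error terms is rho replaced by \<open>C\<close>; the main term
          keeps it.\<close>
        have "real (num_roots_mod f p) * (ln (real p) * (K\<^sup>2 / real p ^ 2 + K)) \<le> real C * (ln (real p) * (K\<^sup>2 / real p ^ 2 + K))"
          using C[OF p(1)] K ln by (intro mult_right_mono) auto
        moreover have "ln (real p) * (real (num_roots_mod f p) * (K\<^sup>2 / real p - K\<^sup>2 / real p ^ 2 - K)) \<le> ln (real p) * real (num_box_multiples f H p)"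
          using num_box_multiples_small[OF p, of f] ln unfolding K_def by (intro mult_left_mono)
        ultimately show "K\<^sup>2 * ?w p - real C * (K\<^sup>2 * (ln (real p) / real p ^ 2)) - real C * (K * ln (real p)) \<le> ln (real p) * real (num_box_multiples f H p)"
          by (simp add: algebra_simps)
      qed
      finally have main: "K\<^sup>2 * root_mertens_sum f H - real C * (K\<^sup>2 * (\<Sum>p\<in>P1. ln (real p) / real p ^ 2)) - real C * (K * (\<Sum>p\<in>P1. ln (real p)))
        \<le> (\<Sum>p\<in>P1. ln (real p) * real (num_box_multiples f H p))" .
      have sq: "real C * (K\<^sup>2 * (\<Sum>p\<in>P1. ln (real p) / real p ^ 2)) \<le> real C * (K\<^sup>2 * 2)"
        by (intro mult_left_mono sum_ln_over_square_le fin) auto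
      have "ln (4 :: real) \<le> 2" using ln_realpow[of 2 2] ln_2_less_1 by simp
      then have "(\<Sum>p\<in>P1. ln (real p)) \<le> real H * 2"
        using theta_le[of H] unfolding P1_def by (meson mult_left_mono of_nat_0_le_iff order_trans)
      then have "(\<Sum>p\<in>P1. ln (real p)) \<le> K" by (simp add: K_def)
      then have "real C * (K * (\<Sum>p\<in>P1. ln (real p))) \<le> real C * (K * K)"
        using K by (intro mult_left_mono) auto
      then show ?thesis using main sq by (simp add: algebra_simps power2_eq_square)
    qed
    have low2: "K\<^sup>2 * ((root_mertens_sum f N - root_mertens_sum f H) / 18) \<le> (\<Sum>p\<in>P2. ln (real p) * real (num_box_multiples f H p))"
    proof -
      have nonneg: "0 \<le> (\<Sum>p\<in>P2. ?w p)"
        by (intro sum_nonneg mult_nonneg_nonneg divide_nonneg_nonneg) (auto simp: P2_def ln_prime_nonneg)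
      \<comment> \<open>Source of the 18: the large primes come with \<open>H^2 / 2\<close>, which
        is at least \<open>K^2 / 18\<close>.\<close>
      have "K\<^sup>2 \<le> (3 * real H)\<^sup>2" using K by (intro power_mono) auto
      then have "K\<^sup>2 / 18 * (\<Sum>p\<in>P2. ?w p) \<le> real H ^ 2 / 2 * (\<Sum>p\<in>P2. ?w p)"
        using nonneg by (intro mult_right_mono) (auto simp: power_mult_distrib)
      also have "\<dots> = (\<Sum>p\<in>P2. real H ^ 2 / 2 * ?w p)" by (simp add: sum_distrib_left)
      also have "\<dots> \<le> (\<Sum>p\<in>P2. ln (real p) * real (num_box_multiples f H p))"
      proof (rule sum_mono)
        fix p assume "p \<in> P2"
        then have p: "prime p" "H < p" "2 * p \<le> H\<^sup>2" using H by (auto simp: P2_def)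
        have "ln (real p) * (real (num_roots_mod f p) * (real H ^ 2 / (2 * real p))) \<le> ln (real p) * real (num_box_multiples f H p)"
          using num_box_multiples_large[OF p] ln_prime_nonneg[OF p(1)] by (intro mult_left_mono)
        then show "real H ^ 2 / 2 * ?w p \<le> ln (real p) * real (num_box_multiples f H p)"
          by (simp add: algebra_simps)
      qed
      finally show ?thesis unfolding diff by simp
    qed
    have "K\<^sup>2 * (root_mertens_sum f H - 3 * real C + (root_mertens_sum f N - root_mertens_sum f H) / 18)
        \<le> K\<^sup>2 * (ln (real_of_int s) + real (degree f) * ln (real H))"
      using upper low1 low2 unfolding P(1) sum.union_disjoint[OF fin(2,3) P(2)] by (simp only: distrib_left)
    then show "root_mertens_sum f H + (root_mertens_sum f N - root_mertens_sum f H) / 18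
      \<le> real (degree f) * ln (real H) + (ln (real_of_int s) + 3 * real C)"
      using K(1) by simp
  qed
qed

text \<open>Write S(N) as \<open>S(H) + (S(N) - S(H)) / 18\<close>, bounded by the box inequality,
  plus 17/18 of the difference, bounded by rho <= d and Mertens. With \<open>ln H\<close> about half
  of \<open>ln N\<close>, the factor of \<open>d * ln N\<close> is 17/18 + 1/36 = 35/36.\<close>

lemma root_mertens_sum_le:
  fixes f :: "int poly"
  assumes irr: "irreducible (map_poly of_int f :: rat poly)" and deg: "degree f \<ge> 2"
    and C: "\<And>p. prime p \<Longrightarrow> num_roots_mod f p \<le> C"
  obtains K :: real and N0 :: nat where
    "\<And>N. N \<ge> N0 \<Longrightarrow> root_mertens_sum f N \<le> 35 / 36 * real (degree f) * ln (real N) + K"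
proof -
  obtain C1 :: real where C1: "\<And>H N. 1 \<le> H \<Longrightarrow> H \<le> N \<Longrightarrow> 2 * N \<le> H\<^sup>2 \<Longrightarrow>
    root_mertens_sum f H + (root_mertens_sum f N - root_mertens_sum f H) / 18
      \<le> real (degree f) * ln (real H) + C1"
    using box_inequality[OF assms] by blast
  define l where "l = nat \<bar>lead_coeff f\<bar>"
  have lc: "lead_coeff f \<noteq> 0" using deg by auto
  let ?d = "real (degree f)"
  show ?thesis
  \<comment> \<open>The threshold makes \<open>sqrt N\<close> at least 2 and at least the leading
    coefficient in absolute value, so primes above \<open>H >= sqrt N\<close> do not divide the
    latter. The 8 rounds up 17/18 * 7 + 1/18.\<close>
  proof (rule that[of "4 + l ^ 2" "C1 + 8 * ?d"])
    fix N assume N: "N \<ge> 4 + l ^ 2"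
    define x where "x = sqrt (real N)"
    have "real N \<ge> real (4 + l ^ 2)" using N by (simp only: of_nat_le_iff)
    then have "real N \<ge> 4 + real l ^ 2" by simp
    then have Nl: "real N \<ge> 4" "real N \<ge> real l ^ 2"
      using zero_le_power2[of "real l"] by linarith+
    have x: "x \<ge> 2" "x \<ge> real l" "x * x = real N"
      using Nl real_le_rsqrt[of 2 "real N"] real_le_rsqrt[of "real l" "real N"] by (auto simp: x_def)
    \<comment> \<open>The least natural number with \<open>H^2 >= 2 * N\<close>; since
      \<open>x >= 2\<close>, rounding up still leaves \<open>H <= 2 * x <= N\<close>.\<close>
    define H where "H = nat \<lceil>sqrt 2 * x\<rceil>"
    have s2: "sqrt 2 \<le> 3 / 2" "1 \<le> sqrt (2 :: real)"
      by (rule real_le_lsqrt, simp_all add: power2_eq_square)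
    have "sqrt 2 * x \<le> 3 / 2 * x" "1 * x \<le> sqrt 2 * x" using s2 x(1) by (auto intro: mult_right_mono)
    then have Hx: "sqrt 2 * x \<le> real H" "real H \<le> 2 * x" "real H \<ge> x" 
      using x(1) unfolding H_def by linarith+
    have H1: "1 \<le> H" using Hx(3) x(1) by linarith
    have "2 * x \<le> x * x" using x(1) by (intro mult_right_mono) auto
    then have HN: "H \<le> N" using Hx(2) x(3) by linarith
    have "(sqrt 2 * x)\<^sup>2 \<le> (real H)\<^sup>2" using Hx(1) x(1) by (intro power_mono) auto
    moreover have "(sqrt 2 * x)\<^sup>2 = 2 * real N"
      by (simp add: power_mult_distrib power2_eq_square[of x] x(3))
    ultimately have "real (2 * N) \<le> real (H\<^sup>2)" by simp
    then have HH: "2 * N \<le> H\<^sup>2" by (simp only: of_nat_le_iff)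
    have "ln (real H) \<le> ln (2 * x)" using Hx H1 by (intro ln_mono) auto
    also have "\<dots> = ln 2 + ln (real N) / 2" using x Nl by (simp add: ln_mult x_def ln_sqrt)
    finally have lnH: "ln (real H) \<le> 1 + ln (real N) / 2" using ln_2_less_1 by linarith
    define P2 where "P2 = {p. prime p \<and> H < p \<and> p \<le> N}"
    have split: "{p. prime p \<and> p \<le> N} = {p. prime p \<and> p \<le> H} \<union> P2" using HN by (auto simp: P2_def)
    have sums: "(\<Sum>p | prime p \<and> p \<le> N. g p) = (\<Sum>p | prime p \<and> p \<le> H. g p) + (\<Sum>p\<in>P2. g p)" for g :: "nat \<Rightarrow> real"
      unfolding split by (rule sum.union_disjoint) (auto simp: P2_def)
    have "root_mertens_sum f N - root_mertens_sum f H = (\<Sum>p\<in>P2. real (num_roots_mod f p) * (ln (real p) / real p))"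
      by (simp add: root_mertens_sum_def sums)
    also have "\<dots> \<le> (\<Sum>p\<in>P2. ?d * (ln (real p) / real p))"
    proof (rule sum_mono)
      fix p assume "p \<in> P2"
      then have p: "prime p" "H < p" by (auto simp: P2_def)
      have "l < p" using p(2) Hx(3) x(2) by linarith
      then have "\<not> int p dvd lead_coeff f"
        using dvd_imp_le_int[OF lc, of "int p"] by (auto simp: l_def)
      then show "real (num_roots_mod f p) * (ln (real p) / real p) \<le> ?d * (ln (real p) / real p)"
        using num_roots_mod_prime_le[OF p(1)] ln_prime_nonneg[OF p(1)] by (intro mult_right_mono) auto
    qed
    also have "\<dots> = ?d * ((\<Sum>p | prime p \<and> p \<le> N. ln (real p) / real p) - (\<Sum>p | prime p \<and> p \<le> H. ln (real p) / real p))"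
      unfolding sums by (simp add: sum_distrib_left)
    \<comment> \<open>The 7 is 5 from the lower Mertens bound at \<open>H\<close> plus
      \<open>ln 4 <= 2\<close> from the upper one at \<open>N\<close>.\<close>
    also have "\<dots> \<le> ?d * (ln (real N) - ln (real H) + 7)"
    proof -
      have "ln (4 :: real) \<le> 2" using ln_realpow[of 2 2] ln_2_less_1 by simp
      then show ?thesis
        using sum_ln_prime_over_le[of N] sum_ln_prime_over_ge[of H] H1 HN by (intro mult_left_mono) auto
    qed
    finally have D: "root_mertens_sum f N - root_mertens_sum f H \<le> ?d * (ln (real N) - ln (real H) + 7)" .
    have combine: "b \<le> u + 17 / 18 * t" if "a + (b - a) / 18 \<le> u" "b - a \<le> t" for a b t u :: real
      using that unfolding diff_divide_distrib by linarith
    have "root_mertens_sum f N \<le> ?d * ln (real H) + C1 + 17 / 18 * (?d * (ln (real N) - ln (real H) + 7))"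
      by (rule combine[OF C1[OF H1 HN HH] D])
    also have "\<dots> = ?d / 18 * ln (real H) + 17 / 18 * ?d * ln (real N) + 17 / 18 * 7 * ?d + C1"
      by (simp add: algebra_simps)
    also have "\<dots> \<le> ?d / 18 * (1 + ln (real N) / 2) + 17 / 18 * ?d * ln (real N) + 17 / 18 * 7 * ?d + C1"
      using lnH by (intro add_right_mono mult_left_mono) auto
    also have "\<dots> \<le> 35 / 36 * ?d * ln (real N) + (C1 + 8 * ?d)"
      by (simp add: field_simps)
    finally show "root_mertens_sum f N \<le> 35 / 36 * ?d * ln (real N) + (C1 + 8 * ?d)" .
  qed
qed

subsection \<open>The lower bound\<close>

theorem theorem1p2:
  fixes f :: "int poly"
  assumes "irreducible (map_poly of_int f :: rat poly)"
    and "degree f \<ge> 2"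
  shows "\<exists>c::real. c > 0 \<and> (\<exists>N0::nat. \<forall>N::nat. N \<ge> N0 \<longrightarrow>
           ln (real_of_int (lcm_values f N)) \<ge> c * real N * ln (real N))"
proof -
  have nz: "poly f x \<noteq> 0" for x
    using homogenization_nonzero[OF assms, of x 1] homogenization_mult[of f x 1] by simp
  have deg0: "degree f > 0" using assms(2) by simp
  obtain D where D: "D \<noteq> 0" "\<And>x. \<exists>s t. D = s * poly f x + t * poly (pderiv f) x"
    using irreducible_separable[OF assms(1)] deg0 by blast
  \<comment> \<open>The extra factor makes the leading coefficient divide \<open>D'\<close>, as the
    bound for prime powers requires.\<close>
  define D' where "D' = lead_coeff f * D"
  have D': "D' \<noteq> 0" "lead_coeff f dvd D'" using D(1) assms(2) by (auto simp: D'_def)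
  have D'_comb: "\<exists>s t. D' = s * poly f x + t * poly (pderiv f) x" for x
  proof -
    obtain s t where "D = s * poly f x + t * poly (pderiv f) x" using D(2) by blast
    then have "D' = (lead_coeff f * s) * poly f x + (lead_coeff f * t) * poly (pderiv f) x"
      by (simp add: D'_def algebra_simps)
    then show ?thesis by blast
  qed
  define C where "C = degree f + nat \<bar>D'\<bar> ^ 3"
  have C: "num_roots_mod f (p ^ k) \<le> C" if "prime p" for p k
    unfolding C_def using D'(1) D'_comb D'(2) that by (rule num_roots_mod_primepow_le)
  have "C > 0" using assms(2) by (simp add: C_def)
  then have C0: "real C > 0" by simp
  have C_prime: "num_roots_mod f p \<le> C" if "prime p" for p using C[OF that, of 1] by simp
  obtain K1 N1 where K1: "\<And>N. N \<ge> N1 \<Longrightarrow> root_mertens_sum f N \<le> 35 / 36 * real (degree f) * ln (real N) + K1"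
    using root_mertens_sum_le[OF assms C_prime] by blast
  obtain K2 where K2: "\<And>N. real (degree f) * real N * ln (real N) - K2 * real N \<le>
      (\<Sum>n\<in>{1..N}. ln \<bar>real_of_int (poly f (int n))\<bar>)"
    using ln_sum_values_ge[of f] nz deg0 by blast
  let ?d = "real (degree f)"
  define K where "K = K1 + K2 + 4 * real C"
  \<comment> \<open>Of the saving \<open>d / 36\<close>, half absorbs \<open>K\<close> once
    \<open>ln N >= 72 * K / d\<close>; dividing the remaining \<open>d / 72\<close> by
    \<open>2 * C\<close> gives \<open>c\<close>.\<close>
  define c where "c = ?d / (144 * real C)"
  have bound: "c * real N * ln (real N) \<le> ln (real_of_int (lcm_values f N))"
    if N: "N \<ge> N1" "ln (real N) \<ge> 72 * K / ?d" for N
  proof -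
    define L where "L = nat (lcm_values f N)"
    \<comment> \<open>The \<open>Lcm\<close> of a finite set is 0 only if the set contains 0, and
      \<open>f\<close> has no integer zero.\<close>
    have "lcm_values f N \<noteq> 0" unfolding lcm_values_def using nz by (subst Lcm_0_iff) auto
    moreover have "lcm_values f N \<ge> 0" unfolding lcm_values_def by (rule Lcm_int_greater_eq_0)
    ultimately have L: "int L = lcm_values f N" "L > 0" by (auto simp: L_def)
    have dvd: "poly f (int n) dvd int L" if "n \<in> {1..N}" for n
      unfolding L lcm_values_def using that by (intro dvd_Lcm) auto
    have "?d * real N * ln (real N) - K2 * real N \<le> real N * (root_mertens_sum f N + 4 * real C) + 2 * real C * ln (real L)"
      by (rule order_trans[OF K2 ln_sum_values_le[OF C L(2)]]) (assumption | rule dvd)+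
    also have "\<dots> \<le> real N * (35 / 36 * ?d * ln (real N) + K1 + 4 * real C) + 2 * real C * ln (real L)"
      using K1[OF N(1)] by (intro add_right_mono mult_left_mono) auto
    finally have "real N * (?d / 36 * ln (real N) - K) \<le> 2 * real C * ln (real L)"
      by (simp add: K_def algebra_simps)
    moreover have "real N * (?d / 72 * ln (real N)) \<le> real N * (?d / 36 * ln (real N) - K)"
      using N(2) assms(2) by (intro mult_left_mono) (auto simp: field_simps)
    ultimately have "real N * (?d / 72 * ln (real N)) \<le> 2 * real C * ln (real L)" by linarith
    then have "c * real N * ln (real N) \<le> ln (real L)"
      using C0 by (simp add: c_def field_simps)
    moreover have "real L = real_of_int (lcm_values f N)" using L(1) by (metis of_int_of_nat_eq)
    ultimately show ?thesis by simp
  qed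
  have "filterlim (\<lambda>N. ln (real N)) at_top sequentially"
    by (rule filterlim_compose[OF ln_at_top filterlim_real_sequentially])
  then have "eventually (\<lambda>N. ln (real N) \<ge> 72 * K / ?d) sequentially"
    by (simp add: filterlim_at_top)
  then obtain N2 where "\<And>N. N \<ge> N2 \<Longrightarrow> ln (real N) \<ge> 72 * K / ?d"
    by (auto simp: eventually_sequentially)
  then have "\<forall>N\<ge>max N1 N2. c * real N * ln (real N) \<le> ln (real_of_int (lcm_values f N))"
    using bound by simp
  moreover have "c > 0" using C0 assms(2) by (simp add: c_def)
  ultimately show ?thesis by blast
qed

end
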